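(* For $i=1,2$ let $G_{i}$ be an $r_{i}$-regular graph of order $p_{i}$ with adjacency spectrum $\{r_{i},\lambda_{i_{2}},\ldots,\lambda_{i_{p_{i}}}\}$. Then the distance Laplacian spectrum of the subdivision-vertex join $G_{1}\dot{\vee}G_{2}$ consists of: (1) for $j=2,\ldots,p_1$, writing $\lambda=\lambda_{1_j}$: $\lambda+\frac{5p_{1}}{2}+\frac{3p_{2}}{2}+\frac{7p_{1}r_{1}}{4}+\frac{5p_{2}r_{2}}{4}-2r_{1}-2\pm\frac{1}{2}\sqrt{\Delta_{1,j}}$, where $\Delta_{1,j}=4\lambda^2+2\lambda p_{1}r_{1}+4\lambda p_{1}+2\lambda p_{2}r_{2}+4\lambda p_{2}+\frac{1}{4}p_{1}^2r_{1}^2+p_{1}^2r_{1}+p_{1}^2+\frac{1}{2}p_{1}p_{2}r_{1}r_{2}+p_{1}p_{2}r_{1}+p_{1}p_{2}r_{2}+2p_{1}p_{2}-4p_{1}r_{1}-8p_{1}+\frac{1}{4}p_{2}^2r_{2}^2+p_{2}^2r_{2}+p_{2}^2-4p_{2}r_{2}-8p_{2}+16r_{1}+16$; (2) for $j=2,\ldots,p_2$, writing $\lambda=\lambda_{2_j}$: $\lambda+\frac{3p_{1}}{2}+\frac{5p_{2}}{2}+\frac{5p_{1}r_{1}}{4}+\frac{7p_{2}r_{2}}{4}-2r_{2}-2\pm\frac{1}{2}\sqrt{\Delta_{2,j}}$, where $\Delta_{2,j}=4\lambda^2+2\lambda p_{1}r_{1}+4\lambda p_{1}+2\lambda p_{2}r_{2}+4\lambda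 p_{2}+\frac{1}{4}p_{1}^2r_{1}^2+p_{1}^2r_{1}+p_{1}^2+\frac{1}{2}p_{1}p_{2}r_{1}r_{2}+p_{1}p_{2}r_{1}+p_{1}p_{2}r_{2}+2p_{1}p_{2}-4p_{1}r_{1}-8p_{1}+\frac{1}{4}p_{2}^2r_{2}^2+p_{2}^2r_{2}+p_{2}^2-4p_{2}r_{2}-8p_{2}+16r_{2}+16$; (3) $3p_{1}+2p_{1}r_{1}+2p_{2}+\frac{3}{2}p_{2}r_{2}-4r_{1}-4$ with multiplicity $\frac{1}{2}p_{1}r_{1}-p_{1}$; (4) $2p_{1}+\frac{3}{2}p_{1}r_{1}+3p_{2}+2p_{2}r_{2}-4r_{2}-4$ with multiplicity $\frac{1}{2}p_{2}r_{2}-p_{2}$; (5) the four eigenvalues of the matrix $$\begin{bmatrix} \frac{3}{2}p_{1}r_{1}+p_{2}+p_{2}r_{2}-2r_{1} & 2r_{1}-\frac{3}{2}p_{1}r_{1} & -p_{2} & -p_{2}r_{2}\\ 4-3p_{1} & 3p_{1}+2p_{2}+\frac{3}{2}p_{2}r_{2}-4 & -2p_{2} & -\frac{3}{2}p_{2}r_{2}\\ -p_{1} & -p_{1}r_{1} & p_{1}+p_{1}r_{1}+\frac{3}{2}p_{2}r_{2}-2r_{2} & 2r_{2}-\frac{3}{2}p_{2}r_{2}\\ -2p_{1} & -\frac{3}{2}p_{1}r_{1} & 4-3p_{2} & 2p_{1}+\frac{3}{2}p_{1}r_{1}+3p_{2}-4\end{bmatrix}.$$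
   Context: The subdivision graph $S(G)$ is obtained from $G$ by inserting a new vertex into every edge; $I(G)$ denotes the set of these new vertices, and $V(G)$ the original vertices. The subdivision-vertex join $G_1\dot{\vee}G_2$ is obtained from $S(G_1)$ and $S(G_2)$ by joining each vertex of $V(G_1)$ with every vertex of $V(G_2)$. For a connected graph, $\mathcal{D}$ is its distance matrix, $Tr$ the diagonal matrix of vertex transmissions ($Tr(u)=\sum_v d(u,v)$), and the distance Laplacian matrix is $\mathcal{L}=Tr-\mathcal{D}$. *)

theory Defs
  imports "Graph_Theory.Graph_Theory" "Jordan_Normal_Form.Char_Poly"
begin

text \<open>Finite simple graphs are \<^locale>\<open>pair_graph\<close>: finite, loop-free digraphs with a
  symmetric set of arcs, so every undirected edge is a pair of opposite arcs.\<close>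

definition edge_set :: "'a pair_pre_digraph \<Rightarrow> 'a set set" where
  "edge_set G = (\<lambda>(u, v). {u, v}) ` parcs G"

text \<open>In \<open>S(G)\<close>, \<open>Inl v\<close> is the original vertex \<open>v\<close> and \<open>Inr e\<close> is the vertex inserted into the
  edge \<open>e\<close>.\<close>

definition subdivision_graph :: "'a pair_pre_digraph \<Rightarrow> ('a + 'a set) pair_pre_digraph" where
  "subdivision_graph G =
    \<lparr> pverts = Inl ` pverts G \<union> Inr ` edge_set G,
      parcs = {(Inl v, Inr e) | v e. e \<in> edge_set G \<and> v \<in> e}
            \<union> {(Inr e, Inl v) | v e. e \<in> edge_set G \<and> v \<in> e} \<rparr>"

definition subdivision_vertex_join ::
  "'a pair_pre_digraph \<Rightarrow> 'b pair_pre_digraph \<Rightarrow>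
    (('a + 'a set) + ('b + 'b set)) pair_pre_digraph" where
  "subdivision_vertex_join G1 G2 =
    \<lparr> pverts = Inl ` pverts (subdivision_graph G1) \<union> Inr ` pverts (subdivision_graph G2),
      parcs = map_prod Inl Inl ` parcs (subdivision_graph G1)
            \<union> map_prod Inr Inr ` parcs (subdivision_graph G2)
            \<union> {(Inl (Inl u), Inr (Inl v)) | u v. u \<in> pverts G1 \<and> v \<in> pverts G2}
            \<union> {(Inr (Inl v), Inl (Inl u)) | u v. u \<in> pverts G1 \<and> v \<in> pverts G2} \<rparr>"

text \<open>The graph distance is the library's weighted shortest-path distance with unit weights. It is
  only meaningful for vertices in the same component, since \<^const>\<open>real_of_ereal\<close> sends
  \<open>\<infinity>\<close> to \<open>0\<close>.\<close>

definition graph_dist :: "'a pair_pre_digraph \<Rightarrow> 'a \<Rightarrow> 'a \<Rightarrow> real" where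
  "graph_dist G u v = real_of_ereal (wf_digraph.\<mu> (with_proj G) (\<lambda>_. 1) u v)"

definition transmission :: "'a pair_pre_digraph \<Rightarrow> 'a \<Rightarrow> real" where
  "transmission G u = (\<Sum>v\<in>pverts G. graph_dist G u v)"

text \<open>Matrices of a graph are taken with respect to a list enumerating its vertices.\<close>

definition enumerates_verts :: "'a list \<Rightarrow> 'a pair_pre_digraph \<Rightarrow> bool" where
  "enumerates_verts vs G \<longleftrightarrow> distinct vs \<and> set vs = pverts G"

definition adjacency_matrix :: "'a list \<Rightarrow> 'a pair_pre_digraph \<Rightarrow> real mat" where
  "adjacency_matrix vs G =
    mat (length vs) (length vs) (\<lambda>(i, j). if (vs ! i, vs ! j) \<in> parcs G then 1 else 0)"

definition distance_matrix :: "'a list \<Rightarrow> 'a pair_pre_digraph \<Rightarrow> real mat" where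
  "distance_matrix vs G =
    mat (length vs) (length vs) (\<lambda>(i, j). graph_dist G (vs ! i) (vs ! j))"

definition transmission_matrix :: "'a list \<Rightarrow> 'a pair_pre_digraph \<Rightarrow> real mat" where
  "transmission_matrix vs G = mat_diag (length vs) (\<lambda>i. transmission G (vs ! i))"

definition distance_laplacian_matrix :: "'a list \<Rightarrow> 'a pair_pre_digraph \<Rightarrow> real mat" where
  "distance_laplacian_matrix vs G = transmission_matrix vs G - distance_matrix vs G"

text \<open>The complex eigenvalues of a real square matrix, with algebraic multiplicity.\<close>

definition eigenvalue_mset :: "real mat \<Rightarrow> complex multiset" where
  "eigenvalue_mset A = proots (char_poly (map_mat complex_of_real A))"

end

theory Submission
  imports Defs
begin

text \<open>
  Order the vertices of the join by the four classes \<open>V(G1), I(G1), V(G2), I(G2)\<close>. Up to the diagonal,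
  every block of the distance matrix is a constant matrix plus \<open>- 2 R\<close>, \<open>- 2 R\<^sup>T\<close> or \<open>- 2 R\<^sup>T R\<close>,
  with \<open>R\<close> the vertex-edge incidence matrix of \<open>G1\<close> or \<open>G2\<close>. Hence \<open>x I - L\<close> is a block diagonal matrix
  \<open>X\<close> plus \<open>U V\<close>, where \<open>U\<close> has the indicator vectors of the classes as columns. By regularity
  \<open>X U = U Y\<close> for a \<open>4 \<times> 4\<close> matrix \<open>Y\<close>, which gives \<open>det (X + U V) det Y = det X det (Y + V U)\<close>, and
  \<open>Y + V U\<close> is \<open>x I\<close> minus the quotient matrix of item (5). Finally \<open>R R\<^sup>T = A + r I\<close> expresses the determinant of
  each half of \<open>X\<close> through the adjacency eigenvalues, and the factors for the eigenvalues \<open>r1, r2\<close>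
  cancel against \<open>det Y\<close>.
\<close>

section \<open>Matrices indexed by lists, and determinants\<close>

text \<open>Neither \<open>X\<close> nor \<open>Y\<close> is invertible for every \<open>x\<close>,
  so nothing is divided: each determinant identity carries its denominators as factors on the other
  side, holds at every complex \<open>x\<close>, and is cancelled only at the end, between nonzero
  polynomials. This also covers \<open>r < 2\<close>, where the stated multiplicity
  \<open>p r / 2 - p\<close> is negative: powers of the edge factor stay on both sides, and
  multiplicities are compared as real numbers. The coefficients come from one distance formula.
  Inside one half of the join, read an original vertex \<open>v\<close> as the set
  \<open>{v}\<close>; then a distance is 2, plus 1 for each inserted vertex among the two, minus
  twice the size of the intersection. For an edge with itself the intersection term removes the
  constant 4, while for an original vertex it removes 2. Kept as \<open>- 2 R\<^sup>T R\<close> for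
  edges but put on the diagonal for vertices, it yields the parameters \<alpha> =
  \<open>x - Tr(v) - 2\<close> and \<beta> = \<open>x - Tr(e)\<close>. The square roots in the claim
  are real roots, so the discriminants must be shown nonnegative; this is where a bound on the
  adjacency eigenvalues enters.\<close>

definition list_mat :: "'i list \<Rightarrow> 'j list \<Rightarrow> ('i \<Rightarrow> 'j \<Rightarrow> 'c) \<Rightarrow> 'c mat" where
  "list_mat xs ys f = mat (length xs) (length ys) (\<lambda>(i, j). f (xs ! i) (ys ! j))"

lemma list_mat_carrier [simp]: "list_mat xs ys f \<in> carrier_mat (length xs) (length ys)"
  by (simp add: list_mat_def)

lemma list_mat_dim [simp]:
  "dim_row (list_mat xs ys f) = length xs" "dim_col (list_mat xs ys f) = length ys"
  by (simp_all add: list_mat_def)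

lemma list_mat_cong:
  assumes "\<And>x y. x \<in> set xs \<Longrightarrow> y \<in> set ys \<Longrightarrow> f x y = g x y"
  shows "list_mat xs ys f = list_mat xs ys g"
  using assms by (auto simp: list_mat_def)

lemma list_mat_map:
  "list_mat (map f xs) (map g ys) h = list_mat xs ys (\<lambda>x y. h (f x) (g y))"
  by (auto simp: list_mat_def)

lemma list_mat_append:
  "list_mat (xs @ xs') (ys @ ys') f =
    four_block_mat (list_mat xs ys f) (list_mat xs ys' f) (list_mat xs' ys f) (list_mat xs' ys' f)"
  by (auto simp: list_mat_def nth_append)

text \<open>Distinctness of the middle list turns a sum over positions into a sum over a set of
  vertices, where incidence counting applies.\<close>

lemma list_mat_mult:
  fixes f :: "'i \<Rightarrow> 'j \<Rightarrow> 'c :: semiring_0"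
  assumes "distinct ys"
  shows "list_mat xs ys f * list_mat ys zs g = list_mat xs zs (\<lambda>x z. \<Sum>y\<in>set ys. f x y * g y z)"
proof -
  have "(\<Sum>j = 0..<length ys. h (ys ! j)) = sum h (set ys)" for h :: "'j \<Rightarrow> 'c"
    using assms by (simp add: atLeast0LessThan sum.reindex_bij_betw bij_betw_nth)
  then show ?thesis
    by (intro eq_matI) (auto simp: list_mat_def scalar_prod_def)
qed

lemma list_mat_add: "list_mat xs ys f + list_mat xs ys g = list_mat xs ys (\<lambda>x y. f x y + g x y)"
  by (auto simp: list_mat_def)

lemma list_mat_one: "distinct xs \<Longrightarrow> 1\<^sub>m (length xs) = list_mat xs xs (\<lambda>x y. if x = y then 1 else 0)"
  by (auto simp: list_mat_def nth_eq_iff_index_eq)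

lemma list_mat_zero: "0\<^sub>m (length xs) (length ys) = list_mat xs ys (\<lambda>_ _. 0)"
  by (auto simp: list_mat_def)

text \<open>The enumeration of the join is arbitrary, whereas the block form needs the vertices
  sorted by class. Rows and columns are permuted alike, so the sign of the permutation occurs
  twice.\<close>

lemma det_list_mat_cong_set:
  assumes "distinct xs" "distinct ys" "set xs = set ys"
  shows "det (list_mat xs xs f) = det (list_mat ys ys f)"
proof -
  let ?n = "length ys"
  have "mset xs = mset ys"
    using assms by (simp add: set_eq_iff_mset_eq_distinct)
  then obtain p where p: "p permutes {..<?n}" and xs: "permute_list p ys = xs"
    by (rule mset_eq_permutation)
  let ?A = "list_mat ys ys f"
  let ?B = "mat ?n ?n (\<lambda>(i, j). ?A $$ (p i, j))"
  have p0: "p permutes {0..<?n}"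
    using p by (simp add: atLeast0LessThan)
  have lt: "p i < ?n" if "i < ?n" for i
    using permutes_in_image[OF p] that by simp
  have B: "?B \<in> carrier_mat ?n ?n"
    by simp
  let ?C = "mat ?n ?n (\<lambda>(i, j). ?B\<^sup>T $$ (p i, j))"
  have "list_mat xs xs f = ?C\<^sup>T"
    unfolding xs[symmetric] using lt p
    by (auto simp: list_mat_def permute_list_nth)
  then have "det (list_mat xs xs f) = det ?C"
    by (simp add: det_transpose[of ?C ?n])
  also have "\<dots> = signof p * det ?B\<^sup>T"
    using det_permute_rows[OF _ p0, of "?B\<^sup>T"] by simp
  also have "\<dots> = signof p * (signof p * det ?A)"
    using det_permute_rows[OF _ p0, of ?A] det_transpose[OF B] by simp
  also have "\<dots> = det ?A"
    by (cases p rule: sign_cases) auto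
  finally show ?thesis .
qed

text \<open>Both sides arise from the block matrix \<open>((X, U), (- V, 1))\<close> by multiplying from the right with
  \<open>((1, 0), (V, 1))\<close> and with \<open>((1, - U), (0, Y))\<close>.\<close>

lemma det_add_mult_intertwining:
  fixes X :: "'a :: idom mat"
  assumes X: "X \<in> carrier_mat n n" and U: "U \<in> carrier_mat n k" and V: "V \<in> carrier_mat k n" and Y: "Y \<in> carrier_mat k k"
    and XU: "X * U = U * Y"
  shows "det (X + U * V) * det Y = det X * det (Y + V * U)"
proof -
  note [simp] = X U V Y carrier_matD[OF X] carrier_matD[OF U] carrier_matD[OF V] carrier_matD[OF Y]
  let ?Z = "four_block_mat X U (- V) (1\<^sub>m k)"
  have Z: "?Z \<in> carrier_mat (n + k) (n + k)"
    by simp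
  let ?P = "four_block_mat (1\<^sub>m n) (0\<^sub>m n k) V (1\<^sub>m k)"
  let ?Q = "four_block_mat (1\<^sub>m n) (- U) (0\<^sub>m k n) Y"
  have "?Z * ?P = four_block_mat (X * 1\<^sub>m n + U * V) (X * 0\<^sub>m n k + U * 1\<^sub>m k)
      (- V * 1\<^sub>m n + 1\<^sub>m k * V) (- V * 0\<^sub>m n k + 1\<^sub>m k * 1\<^sub>m k)"
    by (rule mult_four_block_mat) auto
  moreover have "X * 1\<^sub>m n + U * V = X + U * V" "X * 0\<^sub>m n k + U * 1\<^sub>m k = U"
    "- V * 1\<^sub>m n + 1\<^sub>m k * V = 0\<^sub>m k n" "- V * 0\<^sub>m n k + 1\<^sub>m k * 1\<^sub>m k = 1\<^sub>m k"
    by (simp_all add: right_mult_one_mat[OF X] right_mult_zero_mat[OF X] right_mult_one_mat[OF U]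
        left_add_zero_mat[OF U] right_mult_one_mat[of "- V" k n] left_mult_one_mat[OF V]
        uminus_l_inv_mat[OF V] right_mult_zero_mat[of "- V" k n] left_add_zero_mat[of _ k k])
  ultimately have ZP: "?Z * ?P = four_block_mat (X + U * V) U (0\<^sub>m k n) (1\<^sub>m k)"
    by (simp only:)
  have "det ?Z * det ?P = det (?Z * ?P)"
    by (rule det_mult[OF Z, symmetric]) simp
  also have "\<dots> = det (X + U * V)"
    unfolding ZP by (subst det_four_block_mat_lower_left_zero[of _ n _ k]) auto
  also have "det ?P = 1"
    by (subst det_four_block_mat_upper_right_zero[of _ n _ k]) auto
  finally have 1: "det ?Z = det (X + U * V)"
    by simp
  have "?Z * ?Q = four_block_mat (X * 1\<^sub>m n + U * 0\<^sub>m k n) (X * - U + U * Y)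
      (- V * 1\<^sub>m n + 1\<^sub>m k * 0\<^sub>m k n) (- V * - U + 1\<^sub>m k * Y)"
    by (rule mult_four_block_mat) auto
  moreover have "X * 1\<^sub>m n + U * 0\<^sub>m k n = X" "- V * 1\<^sub>m n + 1\<^sub>m k * 0\<^sub>m k n = - V"
    by (simp_all add: right_mult_one_mat[OF X] right_mult_zero_mat[OF U] right_add_zero_mat[OF X]
        right_mult_one_mat[of "- V" k n] left_mult_one_mat[of _ k] right_add_zero_mat[of _ k n])
  moreover have "X * - U + U * Y = 0\<^sub>m n k"
    using uminus_l_inv_mat[of "X * U" n k] by (simp add: XU[symmetric] mult_carrier_mat[OF X U])
  moreover have "- V * - U + 1\<^sub>m k * Y = Y + V * U"
    using comm_add_mat[OF mult_carrier_mat[OF V U] Y] by (simp add: left_mult_one_mat[OF Y])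
  ultimately have ZQ: "?Z * ?Q = four_block_mat X (0\<^sub>m n k) (- V) (Y + V * U)"
    by (simp only:)
  have "det ?Z * det ?Q = det (?Z * ?Q)"
    by (rule det_mult[OF Z, symmetric]) simp
  also have "\<dots> = det X * det (Y + V * U)"
    unfolding ZQ by (subst det_four_block_mat_upper_right_zero[of _ n _ k]) auto
  also have "det ?Q = det Y"
    by (subst det_four_block_mat_lower_left_zero[of _ n _ k]) auto
  finally show ?thesis
    using 1 by simp
qed

lemma smult_smult_mat: "a \<cdot>\<^sub>m (b \<cdot>\<^sub>m A) = (a * b :: 'a :: semigroup_mult) \<cdot>\<^sub>m A"
  by (intro eq_matI) (simp_all add: mult.assoc)

text \<open>The matrix is the diagonal matrix with entries \<alpha> + 2 and \<beta> minus twice the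
  Gram matrix of the columns of \<open>(1 | R)\<close>; hence only \<open>R * R\<^sup>T\<close>
  survives. The left factor \<open>?P\<close> subtracts \<open>R\<^sup>T\<close> times the first
  block row, which removes \<open>R\<^sup>T * R\<close>. The right factor \<open>?Q\<close> scales
  the first block column by \<beta> so that the lower left block can be cleared without division;
  this costs \<open>\<beta> ^ p\<close>.\<close>

lemma det_subdivision_block:
  fixes R :: "'a :: idom mat"
  assumes R: "R \<in> carrier_mat p q"
  shows "det (four_block_mat (\<alpha> \<cdot>\<^sub>m 1\<^sub>m p) ((-2) \<cdot>\<^sub>m R) ((-2) \<cdot>\<^sub>m R\<^sup>T)
      (\<beta> \<cdot>\<^sub>m 1\<^sub>m q + (-2) \<cdot>\<^sub>m (R\<^sup>T * R))) * \<beta> ^ p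
    = \<beta> ^ q * det ((\<alpha> * \<beta>) \<cdot>\<^sub>m 1\<^sub>m p + (- (2 * (\<alpha> + 2))) \<cdot>\<^sub>m (R * R\<^sup>T))"
proof -
  note [simp] = R carrier_matD[OF R]
  have RT [simp]: "R\<^sup>T \<in> carrier_mat q p" "R * R\<^sup>T \<in> carrier_mat p p" "R\<^sup>T * R \<in> carrier_mat q q"
    by (auto intro: mult_carrier_mat simp del: R intro: R)
  let ?A = "\<alpha> \<cdot>\<^sub>m 1\<^sub>m p" and ?B = "(-2) \<cdot>\<^sub>m R" and ?C = "(-2) \<cdot>\<^sub>m R\<^sup>T"
  let ?D = "\<beta> \<cdot>\<^sub>m 1\<^sub>m q + (-2) \<cdot>\<^sub>m (R\<^sup>T * R)"
  let ?X = "four_block_mat ?A ?B ?C ?D"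
  let ?P = "four_block_mat (1\<^sub>m p) (0\<^sub>m p q) (- R\<^sup>T) (1\<^sub>m q)"
  let ?E = "\<beta> \<cdot>\<^sub>m 1\<^sub>m p" and ?F = "(\<alpha> + 2) \<cdot>\<^sub>m R\<^sup>T"
  let ?Q = "four_block_mat ?E (0\<^sub>m p q) ?F (1\<^sub>m q)"
  let ?C' = "(- \<alpha> - 2) \<cdot>\<^sub>m R\<^sup>T" and ?D' = "\<beta> \<cdot>\<^sub>m 1\<^sub>m q"
  let ?S = "(\<alpha> * \<beta>) \<cdot>\<^sub>m 1\<^sub>m p + (- (2 * (\<alpha> + 2))) \<cdot>\<^sub>m (R * R\<^sup>T)"
  have X: "?X \<in> carrier_mat (p + q) (p + q)"
    by (rule four_block_carrier_mat) simp_all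
  have "?P * ?X = four_block_mat (1\<^sub>m p * ?A + 0\<^sub>m p q * ?C) (1\<^sub>m p * ?B + 0\<^sub>m p q * ?D)
      (- R\<^sup>T * ?A + 1\<^sub>m q * ?C) (- R\<^sup>T * ?B + 1\<^sub>m q * ?D)"
    by (rule mult_four_block_mat[of _ p p _ q _ q _ _ p _ q]) simp_all
  moreover have "1\<^sub>m p * ?A + 0\<^sub>m p q * ?C = ?A" "1\<^sub>m p * ?B + 0\<^sub>m p q * ?D = ?B"
    by (simp_all add: left_mult_one_mat[of _ p] left_mult_zero_mat[of _ q] right_add_zero_mat[of _ p])
  moreover have "- R\<^sup>T * ?A + 1\<^sub>m q * ?C = ?C'"
  proof -
    have "R\<^sup>T * ?A = \<alpha> \<cdot>\<^sub>m R\<^sup>T"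
      by (simp add: mult_smult_distrib[OF RT(1) one_carrier_mat] right_mult_one_mat[OF RT(1)])
    then have "- R\<^sup>T * ?A = - (\<alpha> \<cdot>\<^sub>m R\<^sup>T)"
      by simp
    moreover have "1\<^sub>m q * ?C = ?C"
      by (rule left_mult_one_mat[of _ q p]) simp
    ultimately show ?thesis
      by (auto intro!: eq_matI simp: algebra_simps)
  qed
  moreover have "- R\<^sup>T * ?B + 1\<^sub>m q * ?D = ?D'"
  proof -
    have "R\<^sup>T * ?B = (-2) \<cdot>\<^sub>m (R\<^sup>T * R)"
      by (rule mult_smult_distrib[OF RT(1) R])
    then have "- R\<^sup>T * ?B = - ((-2) \<cdot>\<^sub>m (R\<^sup>T * R))"
      by simp
    moreover have "1\<^sub>m q * ?D = ?D"
      by (rule left_mult_one_mat[of _ q q]) simp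
    ultimately show ?thesis
      by (auto intro!: eq_matI simp del: index_mult_mat(1))
  qed
  ultimately have PX: "?P * ?X = four_block_mat ?A ?B ?C' ?D'"
    by (simp only:)
  have "?P * ?X * ?Q = four_block_mat (?A * ?E + ?B * ?F) (?A * 0\<^sub>m p q + ?B * 1\<^sub>m q)
      (?C' * ?E + ?D' * ?F) (?C' * 0\<^sub>m p q + ?D' * 1\<^sub>m q)"
    unfolding PX by (rule mult_four_block_mat[of _ p p _ q _ q _ _ p _ q]) simp_all
  moreover have "?A * ?E + ?B * ?F = ?S"
  proof -
    have "?A * ?E = (\<alpha> * \<beta>) \<cdot>\<^sub>m 1\<^sub>m p"
      by (simp add: mult_smult_assoc_mat[OF one_carrier_mat smult_carrier_mat[OF one_carrier_mat]]
          left_mult_one_mat[of _ p p] smult_smult_mat)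
    moreover have "?B * ?F = (- (2 * (\<alpha> + 2))) \<cdot>\<^sub>m (R * R\<^sup>T)"
      by (simp add: mult_smult_assoc_mat[OF R smult_carrier_mat[OF RT(1)]] mult_smult_distrib[OF R RT(1)]
          smult_smult_mat)
    ultimately show ?thesis
      by simp
  qed
  moreover have "?A * 0\<^sub>m p q + ?B * 1\<^sub>m q = ?B"
    by (simp add: right_mult_zero_mat[of _ p] right_mult_one_mat[of _ p] left_add_zero_mat[of _ p])
  moreover have "?C' * ?E + ?D' * ?F = 0\<^sub>m q p"
  proof -
    have "?C' * ?E = \<beta> \<cdot>\<^sub>m ?C'"
      by (simp add: mult_smult_distrib[OF smult_carrier_mat[OF RT(1)] one_carrier_mat]
          right_mult_one_mat[OF smult_carrier_mat[OF RT(1)]])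
    moreover have "?D' * ?F = \<beta> \<cdot>\<^sub>m ?F"
      by (simp add: mult_smult_assoc_mat[OF one_carrier_mat smult_carrier_mat[OF RT(1)]]
          left_mult_one_mat[OF smult_carrier_mat[OF RT(1)]])
    ultimately show ?thesis
      by (auto intro!: eq_matI simp: algebra_simps)
  qed
  moreover have "?C' * 0\<^sub>m p q + ?D' * 1\<^sub>m q = ?D'"
    by (simp add: right_mult_zero_mat[of _ q] right_mult_one_mat[of _ q] left_add_zero_mat[of _ q])
  ultimately have PXQ: "?P * ?X * ?Q = four_block_mat ?S ?B (0\<^sub>m q p) ?D'"
    by (simp only:)
  have "det (?P * ?X * ?Q) = det ?P * det ?X * det ?Q"
    using X by (simp add: det_mult[of _ "p + q"] mult_carrier_mat[of _ _ "p + q"])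
  moreover have "det (?P * ?X * ?Q) = det ?S * \<beta> ^ q"
    unfolding PXQ by (subst det_four_block_mat_lower_left_zero[of _ p _ q]) simp_all
  moreover have "det ?P = 1"
    by (subst det_four_block_mat_upper_right_zero[of _ p _ q]) simp_all
  moreover have "det ?Q = \<beta> ^ p"
    by (subst det_four_block_mat_upper_right_zero[of _ p _ q]) simp_all
  ultimately show ?thesis
    by (simp add: mult.commute)
qed

section \<open>Characteristic polynomials as products over eigenvalues\<close>

lemma poly_char_poly:
  fixes A :: "'a :: field mat"
  assumes "A \<in> carrier_mat n n"
  shows "poly (char_poly A) x = det (x \<cdot>\<^sub>m 1\<^sub>m n + (- 1) \<cdot>\<^sub>m A)"
proof -
  have "- char_matrix A x = x \<cdot>\<^sub>m 1\<^sub>m n + (- 1) \<cdot>\<^sub>m A"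
    using assms by (intro eq_matI) (auto simp: char_matrix_def)
  then show ?thesis
    using char_poly_matrix[OF assms] by simp
qed

lemma char_poly_nonzero:
  fixes A :: "'a :: comm_ring_1 mat"
  assumes "A \<in> carrier_mat n n"
  shows "char_poly A \<noteq> 0"
  using degree_monic_char_poly[OF assms] by auto

lemma char_poly_eq_prod_proots:
  fixes A :: "complex mat"
  assumes "A \<in> carrier_mat n n"
  shows "char_poly A = (\<Prod>a\<in>#proots (char_poly A). [:- a, 1:])" "size (proots (char_poly A)) = n"
proof -
  obtain as where as: "char_poly A = (\<Prod>a\<leftarrow>as. [:- a, 1:])" "length as = n"
    using char_poly_factorized[OF assms] by blast
  have "proots (\<Prod>a\<leftarrow>as. [:- a, 1:]) = mset as"
  proof (induction as)
    case (Cons a as)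
    have "(\<Prod>a\<leftarrow>as. [:- a, 1:]) \<noteq> 0"
      by (simp add: prod_list_zero_iff image_iff)
    then have "proots ([:- a, 1:] * (\<Prod>a\<leftarrow>as. [:- a, 1:])) = {#a#} + mset as"
      using Cons by (subst proots_mult) simp_all
    then show ?case
      by simp
  qed simp
  then have m: "proots (char_poly A) = mset as"
    by (simp add: as)
  show "char_poly A = (\<Prod>a\<in>#proots (char_poly A). [:- a, 1:])"
    unfolding m by (simp only: as(1) prod_mset_prod_list flip: mset_map)
  show "size (proots (char_poly A)) = n"
    unfolding m by (simp add: as)
qed

text \<open>A homogeneous form of the factorisation: it is applied with
  \<open>t = 2 * (\<alpha> + 2)\<close>, which vanishes for some arguments. At \<open>t = 0\<close>
  the two sides agree because \<open>proots\<close> has exactly \<open>n\<close> elements.\<close>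

lemma det_pencil_eq_prod_proots:
  fixes A :: "complex mat"
  assumes A: "A \<in> carrier_mat n n"
  shows "det (s \<cdot>\<^sub>m 1\<^sub>m n + (- t) \<cdot>\<^sub>m A) = (\<Prod>a\<in>#proots (char_poly A). s - t * a)"
proof (cases "t = 0")
  case True
  have "s \<cdot>\<^sub>m 1\<^sub>m n + (- t) \<cdot>\<^sub>m A = s \<cdot>\<^sub>m 1\<^sub>m n"
    using A True by (intro eq_matI) auto
  then show ?thesis
    using True char_poly_eq_prod_proots(2)[OF A] by simp
next
  case False
  have "s \<cdot>\<^sub>m 1\<^sub>m n + (- t) \<cdot>\<^sub>m A = t \<cdot>\<^sub>m ((s / t) \<cdot>\<^sub>m 1\<^sub>m n + (- 1) \<cdot>\<^sub>m A)"
    using A False by (intro eq_matI) (auto simp: field_simps)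
  then have "det (s \<cdot>\<^sub>m 1\<^sub>m n + (- t) \<cdot>\<^sub>m A) = t ^ n * poly (char_poly A) (s / t)"
    using A by (simp add: poly_char_poly)
  also have "poly (char_poly A) (s / t) = (\<Prod>a\<in>#proots (char_poly A). s / t - a)"
    by (subst char_poly_eq_prod_proots(1)[OF A]) (simp add: poly_prod_mset image_mset.compositionality o_def)
  also have "t ^ n * \<dots> = (\<Prod>a\<in>#proots (char_poly A). t * (s / t - a))"
    using char_poly_eq_prod_proots(2)[OF A] by (simp add: prod_mset.distrib)
  finally show ?thesis
    using False by (simp add: right_diff_distrib)
qed

section \<open>Distances in the subdivision-vertex join\<close>

text \<open>A function satisfying the breadth-first search conditions from \<open>u\<close> is the distance from \<open>u\<close>:
  \<open>step\<close> bounds every walk from below, and following \<open>pred\<close> backwards yields a shortest one.\<close>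

lemma graph_dist_eqI:
  fixes D :: "'a \<Rightarrow> nat"
  assumes wf: "pair_wf_digraph H" and u: "u \<in> pverts H" "D u = 0"
    and step: "\<And>x y. (x, y) \<in> parcs H \<Longrightarrow> D y \<le> D x + 1"
    and pred: "\<And>v. v \<in> pverts H \<Longrightarrow> v \<noteq> u \<Longrightarrow> \<exists>w. (w, v) \<in> parcs H \<and> D v = D w + 1"
    and v: "v \<in> pverts H"
  shows "graph_dist H u v = real (D v)"
proof -
  interpret pair_wf_digraph H by (rule wf)
  have lower: "real (D y) \<le> real (D x) + awalk_cost (\<lambda>_. 1) p" if "awalk x p y" for x p y
    using that
  proof (induction p arbitrary: x)
    case (Cons a p)
    then have "a \<in> parcs H" "x = fst a" and w: "awalk (snd a) p y"
      by (simp_all add: awalk_Cons_iff)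
    then have "D (snd a) \<le> D x + 1"
      using step[of x "snd a"] by simp
    then show ?case
      using Cons.IH[OF w] by simp
  qed (simp add: awalk_Nil_iff)
  have "\<exists>p. awalk u p y \<and> awalk_cost (\<lambda>_. 1) p = real (D y)" if "y \<in> pverts H" for y
    using that
  proof (induction "D y" arbitrary: y rule: less_induct)
    case less
    show ?case
    proof (cases "y = u")
      case True
      then show ?thesis
        using u by (intro exI[of _ "[]"]) (simp add: awalk_Nil_iff)
    next
      case False
      then obtain w where w: "(w, y) \<in> parcs H" "D y = D w + 1"
        using pred less.prems by blast
      then obtain p where p: "awalk u p w" "awalk_cost (\<lambda>_. 1) p = real (D w)"
        using less.hyps[of w] in_arcsD1[OF w(1)] by auto
      have "awalk w [(w, y)] y"
        using w(1) arc_implies_awalk[OF w(1)] by simp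
      then have "awalk u (p @ [(w, y)]) y"
        using p(1) by (rule awalk_appendI[rotated])
      then show ?thesis
        using p(2) w(2) by (intro exI[of _ "p @ [(w, y)]"]) simp
    qed
  qed
  then obtain p where p: "awalk u p v" "awalk_cost (\<lambda>_. 1) p = real (D v)"
    using v by blast
  have "\<mu> (\<lambda>_. 1) u v = ereal (real (D v))"
  proof (rule antisym)
    show "\<mu> (\<lambda>_. 1) u v \<le> ereal (real (D v))"
      using min_cost_le_walk_cost[OF p(1), of "\<lambda>_. 1"] p(2) by simp
    show "ereal (real (D v)) \<le> \<mu> (\<lambda>_. 1) u v"
      unfolding \<mu>_def using lower u(2) by (intro INF_greatest) fastforce
  qed
  then show ?thesis
    by (simp add: graph_dist_def)
qed

text \<open>Distances between vertices of one half, but measured in the join: a detour through the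
  other half bounds them by 2 between original vertices, by 3 between a vertex and an edge, and by 4
  between edges.\<close>

fun sub_dist :: "'a + 'a set \<Rightarrow> 'a + 'a set \<Rightarrow> nat" where
  "sub_dist (Inl u) (Inl v) = (if u = v then 0 else 2)"
| "sub_dist (Inl u) (Inr e) = (if u \<in> e then 1 else 3)"
| "sub_dist (Inr e) (Inl u) = (if u \<in> e then 1 else 3)"
| "sub_dist (Inr e) (Inr f) = (if e = f then 0 else if e \<inter> f = {} then 4 else 2)"

fun join_dist :: "('a + 'a set) + ('b + 'b set) \<Rightarrow> ('a + 'a set) + ('b + 'b set) \<Rightarrow> nat" where
  "join_dist (Inl a) (Inl b) = sub_dist a b"
| "join_dist (Inr a) (Inr b) = sub_dist a b"
| "join_dist (Inl a) (Inr b) = 1 + of_bool (\<not> isl a) + of_bool (\<not> isl b)"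
| "join_dist (Inr a) (Inl b) = 1 + of_bool (\<not> isl a) + of_bool (\<not> isl b)"

lemma parcs_subdivision_iff [simp]:
  "(Inl u, Inl v) \<notin> parcs (subdivision_graph G)"
  "(Inr e, Inr f) \<notin> parcs (subdivision_graph G)"
  "(Inl u, Inr e) \<in> parcs (subdivision_graph G) \<longleftrightarrow> e \<in> edge_set G \<and> u \<in> e"
  "(Inr e, Inl u) \<in> parcs (subdivision_graph G) \<longleftrightarrow> e \<in> edge_set G \<and> u \<in> e"
  by (auto simp: subdivision_graph_def)

lemma pverts_subdivision: "pverts (subdivision_graph G) = pverts G <+> edge_set G"
  by (simp add: subdivision_graph_def Plus_def)

lemma parcs_join_iff [simp]:
  "(Inl a, Inl b) \<in> parcs (subdivision_vertex_join G1 G2) \<longleftrightarrow> (a, b) \<in> parcs (subdivision_graph G1)"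
  "(Inr c, Inr d) \<in> parcs (subdivision_vertex_join G1 G2) \<longleftrightarrow> (c, d) \<in> parcs (subdivision_graph G2)"
  "(Inl a, Inr d) \<in> parcs (subdivision_vertex_join G1 G2) \<longleftrightarrow> a \<in> Inl ` pverts G1 \<and> d \<in> Inl ` pverts G2"
  "(Inr c, Inl b) \<in> parcs (subdivision_vertex_join G1 G2) \<longleftrightarrow> c \<in> Inl ` pverts G2 \<and> b \<in> Inl ` pverts G1"
  by (force simp: subdivision_vertex_join_def)+

lemma pverts_join:
  "pverts (subdivision_vertex_join G1 G2) =
    (pverts G1 <+> edge_set G1) <+> (pverts G2 <+> edge_set G2)"
  by (simp add: subdivision_vertex_join_def pverts_subdivision Plus_def)

lemma parcs_subdivision_disj:
  assumes "(a, b) \<in> parcs (subdivision_graph G)"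
  shows "(\<exists>v e. a = Inl v \<and> b = Inr e \<and> e \<in> edge_set G \<and> v \<in> e) \<or>
    (\<exists>v e. a = Inr e \<and> b = Inl v \<and> e \<in> edge_set G \<and> v \<in> e)"
  using assms by (cases a; cases b) simp_all

lemma parcs_join_cases:
  assumes "(x, y) \<in> parcs (subdivision_vertex_join G1 G2)"
  obtains (VE1) v e where "x = Inl (Inl v)" "y = Inl (Inr e)" "e \<in> edge_set G1" "v \<in> e"
    | (EV1) v e where "x = Inl (Inr e)" "y = Inl (Inl v)" "e \<in> edge_set G1" "v \<in> e"
    | (VE2) v e where "x = Inr (Inl v)" "y = Inr (Inr e)" "e \<in> edge_set G2" "v \<in> e"
    | (EV2) v e where "x = Inr (Inr e)" "y = Inr (Inl v)" "e \<in> edge_set G2" "v \<in> e"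
    | (VV12) u v where "x = Inl (Inl u)" "y = Inr (Inl v)" "u \<in> pverts G1" "v \<in> pverts G2"
    | (VV21) u v where "x = Inr (Inl v)" "y = Inl (Inl u)" "u \<in> pverts G1" "v \<in> pverts G2"
proof -
  show thesis
  proof (cases x)
    case x: (Inl a)
    show thesis
    proof (cases y)
      case (Inl b)
      with x assms parcs_subdivision_disj[of a b G1] VE1 EV1 show thesis
        by auto
    next
      case (Inr b)
      with x assms VV12 show thesis
        by auto
    qed
  next
    case x: (Inr a)
    show thesis
    proof (cases y)
      case (Inl b)
      with x assms VV21 show thesis
        by auto
    next
      case (Inr b)
      with x assms parcs_subdivision_disj[of a b G2] VE2 EV2 show thesis
        by auto
    qed
  qed
qed

lemma (in pair_wf_digraph) edge_set_subset: "e \<in> edge_set G \<Longrightarrow> e \<subseteq> pverts G"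
  by (auto simp: edge_set_def dest: in_arcsD1 in_arcsD2)

lemma edge_set_nonempty: "e \<in> edge_set G \<Longrightarrow> \<exists>v. v \<in> e"
  by (auto simp: edge_set_def)

lemma pair_wf_digraph_join:
  assumes "pair_wf_digraph G1" "pair_wf_digraph G2"
  shows "pair_wf_digraph (subdivision_vertex_join G1 G2)"
proof -
  interpret G1: pair_wf_digraph G1 by fact
  interpret G2: pair_wf_digraph G2 by fact
  have "x \<in> pverts (subdivision_vertex_join G1 G2) \<and> y \<in> pverts (subdivision_vertex_join G1 G2)"
    if "(x, y) \<in> parcs (subdivision_vertex_join G1 G2)" for x y
    using that by (cases rule: parcs_join_cases)
      (use G1.edge_set_subset G2.edge_set_subset in \<open>auto simp: pverts_join\<close>)
  then show ?thesis
    by unfold_locales auto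
qed

lemma pverts_join_cases:
  assumes "x \<in> pverts (subdivision_vertex_join G1 G2)"
  obtains (VV1) u where "x = Inl (Inl u)" "u \<in> pverts G1"
    | (EE1) e u where "x = Inl (Inr e)" "e \<in> edge_set G1" "u \<in> e"
    | (VV2) u where "x = Inr (Inl u)" "u \<in> pverts G2"
    | (EE2) e u where "x = Inr (Inr e)" "e \<in> edge_set G2" "u \<in> e"
proof -
  from assms consider (V1) u where "x = Inl (Inl u)" "u \<in> pverts G1"
    | (E1) e where "x = Inl (Inr e)" "e \<in> edge_set G1"
    | (V2) u where "x = Inr (Inl u)" "u \<in> pverts G2"
    | (E2) e where "x = Inr (Inr e)" "e \<in> edge_set G2"
    unfolding pverts_join by (elim PlusE) simp_all
  then show thesis
  proof cases
    case V1
    then show thesis by (rule VV1)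
  next
    case E1
    then show thesis using edge_set_nonempty[of _ G1] EE1 by blast
  next
    case V2
    then show thesis by (rule VV2)
  next
    case E2
    then show thesis using edge_set_nonempty[of _ G2] EE2 by blast
  qed
qed

lemma graph_dist_join:
  assumes G: "pair_wf_digraph G1" "pair_wf_digraph G2"
    and ne: "pverts G1 \<noteq> {}" "pverts G2 \<noteq> {}"
    and x: "x \<in> pverts (subdivision_vertex_join G1 G2)" and y: "y \<in> pverts (subdivision_vertex_join G1 G2)"
  shows "graph_dist (subdivision_vertex_join G1 G2) x y = real (join_dist x y)"
proof (rule graph_dist_eqI[OF pair_wf_digraph_join[OF G] x _ _ _ y])
  let ?J = "subdivision_vertex_join G1 G2"
  interpret G1: pair_wf_digraph G1 by fact
  interpret G2: pair_wf_digraph G2 by fact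
  \<comment> \<open>The detour vertices: \<open>w2\<close> precedes an original vertex of
    \<open>G1\<close> on a shortest path from its own half whenever that path has length 2 or 3, and
    \<open>w1\<close> does so for \<open>G2\<close>.\<close>
  obtain w1 w2 where w: "w1 \<in> pverts G1" "w2 \<in> pverts G2"
    using ne by blast
  show "join_dist x x = 0"
    by (cases x; cases "projl x"; cases "projr x") auto
  show "join_dist x b \<le> join_dist x a + 1" if "(a, b) \<in> parcs ?J" for a b
    using that
  proof (cases rule: parcs_join_cases)
    case (VE1 v e)
    with x show ?thesis
      by (cases rule: pverts_join_cases) auto
  next
    case (EV1 v e)
    with x show ?thesis
      by (cases rule: pverts_join_cases) auto
  next
    case (VE2 v e)
    with x show ?thesis
      by (cases rule: pverts_join_cases) auto
  next
    case (EV2 v e)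
    with x show ?thesis
      by (cases rule: pverts_join_cases) auto
  next
    case (VV12 u v)
    with x show ?thesis
      by (cases rule: pverts_join_cases) auto
  next
    case (VV21 u v)
    with x show ?thesis
      by (cases rule: pverts_join_cases) auto
  qed
  show "\<exists>a. (a, b) \<in> parcs ?J \<and> join_dist x b = join_dist x a + 1"
    if b: "b \<in> pverts ?J" "b \<noteq> x" for b
  proof -
    from b(1) show ?thesis
    proof (cases rule: pverts_join_cases)
      case (VV1 v)
      note b' = this
      from x show ?thesis
      proof (cases rule: pverts_join_cases)
        case (VV1 u)
        note xc = this
        show ?thesis
          by (intro exI[of _ "Inr (Inl w2)"]) (use b b' xc w in auto)
      next
        case (EE1 f u)
        note xc = this
        show ?thesis
          by (intro exI[of _ "if v \<in> f then x else Inr (Inl w2)"]) (use b b' xc w in auto)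
      next
        case (VV2 u)
        note xc = this
        show ?thesis
          by (intro exI[of _ x]) (use b' xc in auto)
      next
        case (EE2 f u)
        note xc = this
        show ?thesis
          by (intro exI[of _ "Inr (Inl u)"]) (use b' xc G2.edge_set_subset in auto)
      qed
    next
      case (EE1 e a)
      note b' = this
      from x show ?thesis
      proof (cases rule: pverts_join_cases)
        case (VV1 u)
        note xc = this
        show ?thesis
          by (intro exI[of _ "if u \<in> e then x else Inl (Inl a)"]) (use b' xc in auto)
      next
        case (EE1 f u)
        note xc = this
        show ?thesis
        \<comment> \<open>If the edges are disjoint, every end of \<open>e\<close> is at distance 3
          from \<open>f\<close>, so any end will do; if they meet, the predecessor must be a common
          end.\<close>
        proof (cases "e \<inter> f = {}")
          case True
          then show ?thesis
            by (intro exI[of _ "Inl (Inl a)"]) (use b b' xc in auto)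
        next
          case False
          then obtain d where "d \<in> e" "d \<in> f"
            by blast
          then show ?thesis
            by (intro exI[of _ "Inl (Inl d)"]) (use b b' xc in auto)
        qed
      next
        case (VV2 u)
        note xc = this
        show ?thesis
          by (intro exI[of _ "Inl (Inl a)"]) (use b' xc G1.edge_set_subset in auto)
      next
        case (EE2 f u)
        note xc = this
        show ?thesis
          by (intro exI[of _ "Inl (Inl a)"]) (use b' xc G1.edge_set_subset in auto)
      qed
    next
      case (VV2 v)
      note b' = this
      from x show ?thesis
      proof (cases rule: pverts_join_cases)
        case (VV1 u)
        note xc = this
        show ?thesis
          by (intro exI[of _ x]) (use b' xc in auto)
      next
        case (EE1 f u)
        note xc = this
        show ?thesis
          by (intro exI[of _ "Inl (Inl u)"]) (use b' xc G1.edge_set_subset in auto)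
      next
        case (VV2 u)
        note xc = this
        show ?thesis
          by (intro exI[of _ "Inl (Inl w1)"]) (use b b' xc w in auto)
      next
        case (EE2 f u)
        note xc = this
        show ?thesis
          by (intro exI[of _ "if v \<in> f then x else Inl (Inl w1)"]) (use b b' xc w in auto)
      qed
    next
      case (EE2 e a)
      note b' = this
      from x show ?thesis
      proof (cases rule: pverts_join_cases)
        case (VV1 u)
        note xc = this
        show ?thesis
          by (intro exI[of _ "Inr (Inl a)"]) (use b' xc G2.edge_set_subset in auto)
      next
        case (EE1 f u)
        note xc = this
        show ?thesis
          by (intro exI[of _ "Inr (Inl a)"]) (use b' xc G2.edge_set_subset in auto)
      next
        case (VV2 u)
        note xc = this
        show ?thesis
          by (intro exI[of _ "if u \<in> e then x else Inr (Inl a)"]) (use b' xc in auto)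
      next
        case (EE2 f u)
        note xc = this
        show ?thesis
        proof (cases "e \<inter> f = {}")
          case True
          then show ?thesis
            by (intro exI[of _ "Inr (Inl a)"]) (use b b' xc in auto)
        next
          case False
          then obtain d where "d \<in> e" "d \<in> f"
            by blast
          then show ?thesis
            by (intro exI[of _ "Inr (Inl d)"]) (use b b' xc in auto)
        qed
      qed
    qed
  qed
qed

section \<open>Incidence counts and adjacency spectrum of a regular graph\<close>

locale regular_graph = pair_graph G for G :: "'a pair_pre_digraph" +
  fixes r :: nat
  assumes regular: "v \<in> pverts G \<Longrightarrow> out_degree (with_proj G) v = r"
begin

abbreviation "V \<equiv> pverts G"
abbreviation "E \<equiv> edge_set G"

lemma finite_edge_set: "finite E"
  by (simp add: edge_set_def pair_finite_arcs)

lemma card_edge: "e \<in> E \<Longrightarrow> card e = 2"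
  using no_loops' by (auto simp: edge_set_def)

lemma parcs_sym: "(u, v) \<in> parcs G \<longleftrightarrow> (v, u) \<in> parcs G"
  using pair_sym_arcs by (auto simp: symmetric_conv arc_to_ends_def)

lemma doubleton_mem_edge_set: "{u, v} \<in> E \<longleftrightarrow> (u, v) \<in> parcs G"
  using parcs_sym by (fastforce simp: edge_set_def doubleton_eq_iff image_iff)

lemma mem_edge_set_eq_doubleton: "e \<in> E \<Longrightarrow> u \<in> e \<Longrightarrow> v \<in> e \<Longrightarrow> u \<noteq> v \<Longrightarrow> e = {u, v}"
  by (auto simp: edge_set_def)

text \<open>Degrees count arcs; without loops, each edge at \<open>v\<close> carries exactly one arc
  leaving \<open>v\<close>.\<close>

lemma card_edges_at:
  assumes "v \<in> V"
  shows "card {e \<in> E. v \<in> e} = r"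
proof -
  have "bij_betw (\<lambda>(x, y). {x, y}) (out_arcs (with_proj G) v) {e \<in> E. v \<in> e}"
    unfolding bij_betw_def
  proof
    show "inj_on (\<lambda>(x, y). {x, y}) (out_arcs (with_proj G) v)"
      by (auto simp: inj_on_def out_arcs_def doubleton_eq_iff)
    show "(\<lambda>(x, y). {x, y}) ` out_arcs (with_proj G) v = {e \<in> E. v \<in> e}"
    proof
      show "{e \<in> E. v \<in> e} \<subseteq> (\<lambda>(x, y). {x, y}) ` out_arcs (with_proj G) v"
      proof
        fix e assume "e \<in> {e \<in> E. v \<in> e}"
        then obtain x y where "(x, y) \<in> parcs G" "e = {x, y}" "v = x \<or> v = y"
          by (auto simp: edge_set_def)
        then obtain w where "(v, w) \<in> parcs G" "e = {v, w}"
          using parcs_sym by blast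
        then show "e \<in> (\<lambda>(x, y). {x, y}) ` out_arcs (with_proj G) v"
          by (intro image_eqI[of _ _ "(v, w)"]) (auto simp: out_arcs_def)
      qed
    qed (auto simp: out_arcs_def edge_set_def)
  qed
  then have "card (out_arcs (with_proj G) v) = card {e \<in> E. v \<in> e}"
    by (rule bij_betw_same_card)
  then show ?thesis
    using regular[OF assms] by (simp add: out_degree_def)
qed

lemma sum_incidence_edges: "v \<in> V \<Longrightarrow> (\<Sum>e\<in>E. of_bool (v \<in> e)) = (of_nat r :: 'c :: comm_ring_1)"
  using card_edges_at finite_edge_set by (simp add: sum_of_bool_eq Int_def)

lemma sum_incidence_verts: "e \<in> E \<Longrightarrow> (\<Sum>v\<in>V. of_bool (v \<in> e)) = (2 :: 'c :: comm_ring_1)"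
  using card_edge edge_set_subset pair_finite_verts
  by (simp add: sum_of_bool_eq Int_absorb1 flip: Int_def)

text \<open>These are the entries of \<open>R * R\<^sup>T\<close>: two distinct vertices of a simple
  graph lie on at most one common edge.\<close>

lemma sum_incidence_pair:
  assumes "u \<in> V" "v \<in> V"
  shows "(\<Sum>e\<in>E. of_bool (u \<in> e) * of_bool (v \<in> e)) =
    (if u = v then of_nat r else of_bool ((u, v) \<in> parcs G) :: 'c :: comm_ring_1)"
proof (cases "u = v")
  case True
  then show ?thesis
    using sum_incidence_edges[OF assms(1), where 'c = 'c] by (simp del: sum_of_bool_eq flip: of_bool_conj)
next
  case False
  have "{e \<in> E. u \<in> e \<and> v \<in> e} = (if (u, v) \<in> parcs G then {{u, v}} else {})"
    using False doubleton_mem_edge_set mem_edge_set_eq_doubleton[of _ u v] by auto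
  then have "card {e \<in> E. u \<in> e \<and> v \<in> e} = of_bool ((u, v) \<in> parcs G)"
    by simp
  then show ?thesis
    using False finite_edge_set by (simp add: sum_of_bool_eq Int_def flip: of_bool_conj)
qed

lemma sum_incidence_Int:
  assumes "e \<in> E"
  shows "(\<Sum>v\<in>V. of_bool (v \<in> e) * of_bool (v \<in> f)) = (of_nat (card (e \<inter> f)) :: 'c :: comm_ring_1)"
proof -
  have "V \<inter> {v. v \<in> e \<and> v \<in> f} = e \<inter> f"
    using edge_set_subset[OF assms] by auto
  then show ?thesis
    using pair_finite_verts by (simp add: sum_of_bool_eq flip: of_bool_conj)
qed

text \<open>Handshake: incident pairs are counted by edges and by vertices.\<close>

lemma double_card_edge_set: "2 * card E = r * card V"
proof -
  have "2 * int (card E) = (\<Sum>e\<in>E. \<Sum>v\<in>V. of_bool (v \<in> e))"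
    by (simp add: sum_incidence_verts del: sum_of_bool_eq)
  also have "\<dots> = (\<Sum>v\<in>V. \<Sum>e\<in>E. of_bool (v \<in> e))"
    by (rule sum.swap)
  also have "\<dots> = int (r * card V)"
    by (simp add: sum_incidence_edges del: sum_of_bool_eq)
  finally show ?thesis
    by linarith
qed

text \<open>A row sum of \<open>R\<^sup>T * R\<close>: each of the two ends of \<open>e\<close> lies
  on \<open>r\<close> edges, with \<open>e\<close> itself counted at both ends.\<close>

lemma sum_card_Int_edges:
  assumes "e \<in> E"
  shows "(\<Sum>f\<in>E. of_nat (card (e \<inter> f))) = (2 * of_nat r :: 'c :: comm_ring_1)"
proof -
  have "(\<Sum>f\<in>E. of_nat (card (e \<inter> f))) = (\<Sum>f\<in>E. \<Sum>v\<in>V. of_bool (v \<in> e) * of_bool (v \<in> f) :: 'c)"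
    by (simp add: sum_incidence_Int[OF assms])
  also have "\<dots> = (\<Sum>v\<in>V. of_bool (v \<in> e) * (\<Sum>f\<in>E. of_bool (v \<in> f)))"
    by (subst sum.swap) (simp add: sum_distrib_left)
  also have "\<dots> = (\<Sum>v\<in>V. of_bool (v \<in> e) * of_nat r)"
    by (simp add: sum_incidence_edges del: sum_of_bool_eq)
  finally show ?thesis
    using sum_incidence_verts[OF assms, where 'c = 'c] by (simp del: sum_of_bool_eq flip: sum_distrib_right)
qed

lemma sub_dist_vert_edge: "of_nat (sub_dist (Inl v) (Inr e)) = (3 - 2 * of_bool (v \<in> e) :: 'c :: comm_ring_1)"
  "of_nat (sub_dist (Inr e) (Inl v)) = (3 - 2 * of_bool (v \<in> e) :: 'c :: comm_ring_1)"
  by simp_all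

text \<open>Distinct edges of a simple graph share at most one vertex, so the three cases of the
  distance become linear in the intersection size 2, 1 or 0.\<close>

lemma sub_dist_edge_edge:
  assumes "e \<in> E" "f \<in> E"
  shows "of_nat (sub_dist (Inr e) (Inr f)) = (4 - 2 * of_nat (card (e \<inter> f)) :: 'c :: comm_ring_1)"
proof -
  consider "e = f" | "e \<noteq> f" "e \<inter> f = {}" | v where "e \<noteq> f" "v \<in> e" "v \<in> f"
    by blast
  then show ?thesis
  proof cases
    case 3
    then have "e \<inter> f = {v}"
      using mem_edge_set_eq_doubleton[OF assms(1)] mem_edge_set_eq_doubleton[OF assms(2)] by blast
    then show ?thesis
      using 3 by auto
  qed (use card_edge[OF assms(1)] in auto)
qed

lemma sum_sub_dist:
  shows "u \<in> V \<Longrightarrow> (\<Sum>v\<in>V. of_nat (sub_dist (Inl u) (Inl v))) = (2 * of_nat (card V) - 2 :: 'c :: comm_ring_1)"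
    and "u \<in> V \<Longrightarrow> (\<Sum>e\<in>E. of_nat (sub_dist (Inl u) (Inr e))) = (3 * of_nat (card E) - 2 * of_nat r :: 'c)"
    and "e \<in> E \<Longrightarrow> (\<Sum>v\<in>V. of_nat (sub_dist (Inr e) (Inl v))) = (3 * of_nat (card V) - 4 :: 'c)"
    and "e \<in> E \<Longrightarrow> (\<Sum>f\<in>E. of_nat (sub_dist (Inr e) (Inr f))) = (4 * of_nat (card E) - 4 * of_nat r :: 'c)"
proof -
  have "(\<Sum>v\<in>V. of_nat (sub_dist (Inl u) (Inl v))) = (\<Sum>v\<in>V. 2 - (if u = v then 2 else 0) :: 'c)"
    by (intro sum.cong) auto
  then show "u \<in> V \<Longrightarrow> (\<Sum>v\<in>V. of_nat (sub_dist (Inl u) (Inl v))) = (2 * of_nat (card V) - 2 :: 'c)"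
    using pair_finite_verts by (simp add: sum_subtractf mult.commute)
  show "u \<in> V \<Longrightarrow> (\<Sum>e\<in>E. of_nat (sub_dist (Inl u) (Inr e))) = (3 * of_nat (card E) - 2 * of_nat r :: 'c)"
    unfolding sub_dist_vert_edge
    by (simp add: sum_subtractf sum_incidence_edges mult.commute[of 3] del: sum_of_bool_eq flip: sum_distrib_left)
  show "e \<in> E \<Longrightarrow> (\<Sum>v\<in>V. of_nat (sub_dist (Inr e) (Inl v))) = (3 * of_nat (card V) - 4 :: 'c)"
    unfolding sub_dist_vert_edge
    by (simp add: sum_subtractf sum_incidence_verts mult.commute[of 3] del: sum_of_bool_eq flip: sum_distrib_left)
  show "(\<Sum>f\<in>E. of_nat (sub_dist (Inr e) (Inr f))) = (4 * of_nat (card E) - 4 * of_nat r :: 'c)"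
    if e: "e \<in> E"
  proof -
    have "(\<Sum>f\<in>E. of_nat (sub_dist (Inr e) (Inr f))) = (\<Sum>f\<in>E. 4 - 2 * of_nat (card (e \<inter> f)) :: 'c)"
      using e by (intro sum.cong refl sub_dist_edge_edge)
    then show ?thesis
      using e by (simp add: sum_subtractf sum_card_Int_edges mult.commute[of 4] del: sum_of_bool_eq flip: sum_distrib_left)
  qed
qed

end

text \<open>With \<open>R\<close> the incidence matrix, this is
  \<open>((\<alpha> I, - 2 R), (- 2 R\<^sup>T, \<beta> I - 2 R\<^sup>T R))\<close>.\<close>

fun half_block :: "'c \<Rightarrow> 'c \<Rightarrow> 'a + 'a set \<Rightarrow> 'a + 'a set \<Rightarrow> 'c :: comm_ring_1" where
  "half_block \<alpha> \<beta> (Inl u) (Inl v) = (if u = v then \<alpha> else 0)"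
| "half_block \<alpha> \<beta> (Inl u) (Inr e) = - 2 * of_bool (u \<in> e)"
| "half_block \<alpha> \<beta> (Inr e) (Inl u) = - 2 * of_bool (u \<in> e)"
| "half_block \<alpha> \<beta> (Inr e) (Inr f) = (if e = f then \<beta> else 0) - 2 * of_nat (card (e \<inter> f))"

context regular_graph
begin

lemma adjacency_list_mat:
  "map_mat complex_of_real (adjacency_matrix vs G) =
    list_mat vs vs (\<lambda>u v. of_bool ((u, v) \<in> parcs G))"
  by (auto simp: adjacency_matrix_def list_mat_def)

lemma det_half_block:
  assumes vs: "enumerates_verts vs G" and es: "distinct es" "set es = E"
  shows "det (list_mat (map Inl vs @ map Inr es) (map Inl vs @ map Inr es) (half_block \<alpha> \<beta>)) * \<beta> ^ card V
    = \<beta> ^ card E * (\<Prod>a\<in>#eigenvalue_mset (adjacency_matrix vs G).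
        \<alpha> * \<beta> - 2 * (\<alpha> + 2) * (of_nat r + a))"
proof -
  have vs': "distinct vs" "set vs = V"
    using vs by (auto simp: enumerates_verts_def)
  then have len: "length vs = card V" "length es = card E"
    using es distinct_card by metis+
  define A where "A = map_mat complex_of_real (adjacency_matrix vs G)"
  have A: "A \<in> carrier_mat (length vs) (length vs)"
    by (simp add: A_def adjacency_matrix_def)
  define R where "R = list_mat vs es (\<lambda>v e. of_bool (v \<in> e) :: complex)"
  have R: "R \<in> carrier_mat (length vs) (length es)"
    by (simp add: R_def)
  have RT: "R\<^sup>T = list_mat es vs (\<lambda>e v. of_bool (v \<in> e))"
    by (auto simp: R_def list_mat_def)
  have one: "c \<cdot>\<^sub>m 1\<^sub>m (length xs) = list_mat xs xs (\<lambda>x y. if x = y then c else 0)"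
    if "distinct xs" for xs :: "'z list" and c :: complex
    using that by (auto simp: list_mat_one list_mat_def)
  have RTR: "R\<^sup>T * R = list_mat es es (\<lambda>e f. of_nat (card (e \<inter> f)))"
    unfolding RT unfolding R_def list_mat_mult[OF vs'(1)]
    by (intro list_mat_cong) (simp only: vs'(2) es(2) sum_incidence_Int)
  have "R * R\<^sup>T = list_mat vs vs (\<lambda>u v. if u = v then of_nat r else of_bool ((u, v) \<in> parcs G))"
    unfolding RT unfolding R_def list_mat_mult[OF es(1)]
    by (intro list_mat_cong) (simp only: vs'(2) es(2) sum_incidence_pair)
  \<comment> \<open>Without loops the adjacency matrix has zero diagonal, so the degrees split off
    as a scalar matrix.\<close>
  also have "\<dots> = of_nat r \<cdot>\<^sub>m 1\<^sub>m (length vs) + A"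
    unfolding one[OF vs'(1)] A_def adjacency_list_mat list_mat_add
    using no_loops' by (intro list_mat_cong) auto
  finally have RRT: "R * R\<^sup>T = of_nat r \<cdot>\<^sub>m 1\<^sub>m (length vs) + A" .
  have "list_mat (map Inl vs @ map Inr es) (map Inl vs @ map Inr es) (half_block \<alpha> \<beta>) =
      four_block_mat (\<alpha> \<cdot>\<^sub>m 1\<^sub>m (length vs)) ((-2) \<cdot>\<^sub>m R) ((-2) \<cdot>\<^sub>m R\<^sup>T)
        (\<beta> \<cdot>\<^sub>m 1\<^sub>m (length es) + (-2) \<cdot>\<^sub>m (R\<^sup>T * R))"
    unfolding list_mat_append list_mat_map RTR one[OF vs'(1)] one[OF es(1)]
    by (intro cong_four_block_mat) (auto simp: RT R_def list_mat_def)
  then have "det (list_mat (map Inl vs @ map Inr es) (map Inl vs @ map Inr es) (half_block \<alpha> \<beta>)) * \<beta> ^ card V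
      = \<beta> ^ card E * det ((\<alpha> * \<beta>) \<cdot>\<^sub>m 1\<^sub>m (length vs) + (- (2 * (\<alpha> + 2))) \<cdot>\<^sub>m (R * R\<^sup>T))"
    using det_subdivision_block[OF R] by (simp add: len)
  also have "(\<alpha> * \<beta>) \<cdot>\<^sub>m 1\<^sub>m (length vs) + (- (2 * (\<alpha> + 2))) \<cdot>\<^sub>m (R * R\<^sup>T) =
      (\<alpha> * \<beta> - 2 * (\<alpha> + 2) * of_nat r) \<cdot>\<^sub>m 1\<^sub>m (length vs) + (- (2 * (\<alpha> + 2))) \<cdot>\<^sub>m A"
    unfolding RRT using A by (intro eq_matI) (auto simp: algebra_simps)
  also have "det \<dots> = (\<Prod>a\<in>#eigenvalue_mset (adjacency_matrix vs G).
      \<alpha> * \<beta> - 2 * (\<alpha> + 2) * of_nat r - 2 * (\<alpha> + 2) * a)"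
    unfolding det_pencil_eq_prod_proots[OF A] by (simp add: eigenvalue_mset_def A_def)
  finally show ?thesis
    by (simp add: algebra_simps)
qed

text \<open>Read the eigenvalue equation at a coordinate \<open>i\<close> of largest modulus
  \<open>m\<close>: its row has exactly \<open>r\<close> ones, so \<open>norm a * m\<close> is at
  most \<open>r * m\<close>. What is needed later is the lower bound \<open>- r\<close> for real
  eigenvalues.\<close>

lemma norm_eigenvalue_adjacency_le:
  assumes vs: "enumerates_verts vs G" and a: "a \<in># eigenvalue_mset (adjacency_matrix vs G)"
  shows "norm a \<le> r"
proof -
  have vs': "distinct vs" "set vs = V"
    using vs by (auto simp: enumerates_verts_def)
  let ?n = "length vs"
  define A where "A = map_mat complex_of_real (adjacency_matrix vs G)"
  have A: "A \<in> carrier_mat ?n ?n"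
    by (simp add: A_def adjacency_matrix_def)
  have "poly (char_poly A) a = 0"
    using a char_poly_nonzero[OF A] by (simp add: eigenvalue_mset_def A_def)
  then obtain v where v: "v \<in> carrier_vec ?n" "v \<noteq> 0\<^sub>v ?n" "A *\<^sub>v v = a \<cdot>\<^sub>v v"
    using A by (auto simp: eigenvalue_root_char_poly[OF A, symmetric] eigenvalue_def eigenvector_def)
  then obtain k where k: "k < ?n" "v $ k \<noteq> 0"
    by (metis carrier_vecD eq_vecI index_zero_vec)
  define m where "m = Max ((\<lambda>i. norm (v $ i)) ` {..<?n})"
  have m: "norm (v $ i) \<le> m" if "i < ?n" for i
    using that by (auto simp: m_def)
  have "m \<in> (\<lambda>i. norm (v $ i)) ` {..<?n}"
    unfolding m_def using k(1) by (intro Max_in) auto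
  then obtain i where i: "i < ?n" "norm (v $ i) = m"
    by auto
  have m0: "m > 0"
    using m[OF k(1)] k(2) by (meson less_le_trans zero_less_norm_iff)
  have "norm a * m = norm ((A *\<^sub>v v) $ i)"
    using v i by (simp add: norm_mult)
  also have "(A *\<^sub>v v) $ i = (\<Sum>j<?n. of_bool ((vs ! i, vs ! j) \<in> parcs G) * v $ j)"
    using v(1) i(1) unfolding A_def adjacency_list_mat
    by (auto simp: list_mat_def scalar_prod_def atLeast0LessThan)
  also have "norm \<dots> \<le> (\<Sum>j<?n. of_bool ((vs ! i, vs ! j) \<in> parcs G) * m)"
    by (intro sum_norm_le) (use m in \<open>auto simp: norm_mult\<close>)
  also have "\<dots> = (\<Sum>w\<in>V. of_bool ((vs ! i, w) \<in> parcs G)) * m"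
    using sum.reindex_bij_betw[OF bij_betw_nth[of vs "{..<?n}" V], of "\<lambda>w. of_bool ((vs ! i, w) \<in> parcs G) :: real"] vs'
    by (simp del: sum_of_bool_eq sum_mult_of_bool_eq sum_of_bool_mult_eq flip: sum_distrib_right)
  also have "(\<Sum>w\<in>V. of_bool ((vs ! i, w) \<in> parcs G)) = real r"
  proof -
    have "V \<inter> {w. (vs ! i, w) \<in> parcs G} = snd ` out_arcs (with_proj G) (vs ! i)"
      by (force simp: out_arcs_def dest: in_arcsD2)
    moreover have "inj_on snd (out_arcs (with_proj G) (vs ! i))"
      by (auto simp: inj_on_def out_arcs_def)
    ultimately have "card (V \<inter> {w. (vs ! i, w) \<in> parcs G}) = out_degree (with_proj G) (vs ! i)"
      by (simp add: card_image out_degree_def)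
    moreover have "vs ! i \<in> V"
      using i vs' nth_mem by blast
    ultimately show ?thesis
      using pair_finite_verts by (simp add: sum_of_bool_eq regular)
  qed
  finally show ?thesis
    using m0 by simp
qed

end

section \<open>The distance Laplacian of the join\<close>

fun block_sum :: "('i \<Rightarrow> 'i \<Rightarrow> 'c) \<Rightarrow> ('j \<Rightarrow> 'j \<Rightarrow> 'c) \<Rightarrow> 'i + 'j \<Rightarrow> 'i + 'j \<Rightarrow> 'c :: zero" where
  "block_sum f g (Inl a) (Inl b) = f a b"
| "block_sum f g (Inr a) (Inr b) = g a b"
| "block_sum f g (Inl a) (Inr b) = 0"
| "block_sum f g (Inr a) (Inl b) = 0"

lemma det_block_sum:
  fixes f :: "'i \<Rightarrow> 'i \<Rightarrow> 'c :: idom"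
  shows "det (list_mat (map Inl xs @ map Inr ys) (map Inl xs @ map Inr ys) (block_sum f g)) =
    det (list_mat xs xs f) * det (list_mat ys ys g)"
  unfolding list_mat_append list_mat_map
  by (simp add: det_four_block_mat_lower_left_zero[of _ "length xs" _ "length ys"] flip: list_mat_zero)

lemma Inl_in_Plus_iff [simp]: "Inl a \<in> A <+> B \<longleftrightarrow> a \<in> A"
  and Inr_in_Plus_iff [simp]: "Inr b \<in> A <+> B \<longleftrightarrow> b \<in> B"
  by auto

abbreviation edge_type :: "'a + 'b \<Rightarrow> bool" where
  "edge_type a \<equiv> \<not> isl a"

abbreviation vert_class :: "('a + 'a set) + ('b + 'b set) \<Rightarrow> bool + bool" where
  "vert_class \<equiv> map_sum edge_type edge_type"

text \<open>The four classes of vertices of the join are \<open>Inl False\<close>, \<open>Inl True\<close>, \<open>Inr False\<close>, \<open>Inr True\<close>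
  for \<open>V(G1)\<close>, \<open>I(G1)\<close>, \<open>V(G2)\<close>, \<open>I(G2)\<close>. The distance of two vertices is \<open>class_dist\<close> of their
  classes up to a correction on the diagonal blocks of the join.\<close>

fun class_dist :: "bool + bool \<Rightarrow> bool + bool \<Rightarrow> nat" where
  "class_dist (Inl i) (Inl j) = 2 + of_bool i + of_bool j"
| "class_dist (Inr i) (Inr j) = 2 + of_bool i + of_bool j"
| "class_dist (Inl i) (Inr j) = 1 + of_bool i + of_bool j"
| "class_dist (Inr i) (Inl j) = 1 + of_bool i + of_bool j"

text \<open>Row sums of \<open>half_block\<close> over the columns of one type: a vertex lies on
  \<open>r\<close> edges, an edge has two ends (hence \<open>- 4\<close>), and the intersection
  sizes along an edge row add up to \<open>2 * r\<close>.\<close>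

fun quotient_block :: "'c \<Rightarrow> 'c \<Rightarrow> 'c \<Rightarrow> bool \<Rightarrow> bool \<Rightarrow> 'c :: comm_ring_1" where
  "quotient_block \<alpha> \<beta> r False False = \<alpha>"
| "quotient_block \<alpha> \<beta> r False True = - 2 * r"
| "quotient_block \<alpha> \<beta> r True False = - 4"
| "quotient_block \<alpha> \<beta> r True True = \<beta> - 4 * r"

text \<open>The right-hand side keeps \<open>r + r\<close> to display the factor that
  \<open>det_half_block\<close> yields for the adjacency eigenvalue \<open>a = r\<close>; this makes
  the later cancellation possible.\<close>

lemma det_quotient_block:
  fixes \<alpha> \<beta> r :: "'c :: idom"
  shows "det (list_mat [False, True] [False, True] (quotient_block \<alpha> \<beta> r)) = \<alpha> * \<beta> - 2 * (\<alpha> + 2) * (r + r)"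
proof -
  have single: "list_mat [x] [y] h = mat 1 1 (\<lambda>_. h x y)" for x y and h :: "bool \<Rightarrow> bool \<Rightarrow> 'c"
    by (auto simp: list_mat_def)
  have "list_mat ([False] @ [True]) ([False] @ [True]) (quotient_block \<alpha> \<beta> r) =
      four_block_mat (mat 1 1 (\<lambda>_. \<alpha>)) (mat 1 1 (\<lambda>_. - 2 * r)) (mat 1 1 (\<lambda>_. - 4)) (mat 1 1 (\<lambda>_. \<beta> - 4 * r))"
    unfolding list_mat_append single by simp
  moreover have "det \<dots> = det (mat 1 1 (\<lambda>_. \<alpha>) * mat 1 1 (\<lambda>_. \<beta> - 4 * r) - mat 1 1 (\<lambda>_. - 2 * r) * mat 1 1 (\<lambda>_. - 4))"
    by (rule det_four_block_mat[of _ 1]) (auto intro!: eq_matI simp: scalar_prod_def mult.commute)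
  moreover have "\<dots> = \<alpha> * (\<beta> - 4 * r) - 8 * r"
    by (subst det_single) (auto simp: scalar_prod_def)
  ultimately show ?thesis
    by (simp add: algebra_simps)
qed

context regular_graph
begin

lemma sum_half_block:
  assumes "a \<in> V <+> E"
  shows "(\<Sum>b\<in>V <+> E. half_block \<alpha> \<beta> a b * of_bool (edge_type b = i)) =
    (quotient_block \<alpha> \<beta> (of_nat r) (edge_type a) i :: 'c :: comm_ring_1)"
proof -
  note [simp del] = sum_of_bool_eq sum_mult_of_bool_eq sum_of_bool_mult_eq
  have "(\<Sum>b\<in>V <+> E. half_block \<alpha> \<beta> a b * of_bool (edge_type b = i)) =
      (if i then \<Sum>e\<in>E. half_block \<alpha> \<beta> a (Inr e) else \<Sum>v\<in>V. half_block \<alpha> \<beta> a (Inl v))"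
    using pair_finite_verts finite_edge_set by (simp add: sum.Plus)
  also have "\<dots> = quotient_block \<alpha> \<beta> (of_nat r) (edge_type a) i"
  proof (cases a)
    case (Inl u)
    then have "u \<in> V"
      using assms by auto
    then show ?thesis
      using Inl pair_finite_verts by (cases i) (simp_all add: sum_incidence_edges sum_negf flip: sum_distrib_left)
  next
    case (Inr e)
    then have "e \<in> E"
      using assms by auto
    then show ?thesis
      using Inr finite_edge_set
      by (cases i) (simp_all add: sum_incidence_verts sum_card_Int_edges sum_subtractf sum_negf flip: sum_distrib_left)
  qed
  finally show ?thesis .
qed

text \<open>Here \<open>d\<close> stands for \<open>z\<close> minus the transmission of
  \<open>a\<close>. On the vertex diagonal the class constant 2 must be subtracted again; on the
  edge diagonal \<open>2 * card (e \<inter> e)\<close> already cancels the constant 4. Hence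
  \<open>d - 2\<close> and \<open>d\<close>.\<close>

lemma sub_dist_half_block:
  assumes "a \<in> V <+> E" "b \<in> V <+> E"
  shows "(if a = b then d else 0) + of_nat (sub_dist a b) =
    half_block (d - 2) d a b + (2 + of_bool (edge_type a) + of_bool (edge_type b) :: 'c :: comm_ring_1)"
proof (cases a; cases b)
  fix e f assume "a = Inr e" "b = Inr f"
  then show ?thesis
    using assms by (auto simp: sub_dist_edge_edge simp del: sub_dist.simps)
qed (use assms in auto)

end

fun class_size :: "nat \<Rightarrow> nat \<Rightarrow> nat \<Rightarrow> nat \<Rightarrow> bool + bool \<Rightarrow> nat" where
  "class_size p q p' q' (Inl i) = (if i then q else p)"
| "class_size p q p' q' (Inr i) = (if i then q' else p')"

abbreviation class_list :: "(bool + bool) list" where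
  "class_list \<equiv> map Inl [False, True] @ map Inr [False, True]"

lemma UNIV_bool_sum: "(UNIV :: (bool + bool) set) = {Inl False, Inl True, Inr False, Inr True}"
  by (auto simp: UNIV_sum UNIV_bool)

text \<open>The classes form an equitable partition of the block diagonal part, with quotient given by
  \<^const>\<open>quotient_block\<close>, and the rest of the matrix is constant on pairs of classes.\<close>

lemma det_join_block:
  fixes \<alpha>1 \<beta>1 \<alpha>2 \<beta>2 :: "'c :: idom"
  assumes G: "regular_graph G1 r1" "regular_graph G2 r2"
    and xs: "distinct xs" "set xs = pverts G1 <+> edge_set G1"
    and ys: "distinct ys" "set ys = pverts G2 <+> edge_set G2"
  shows "det (list_mat (map Inl xs @ map Inr ys) (map Inl xs @ map Inr ys)
      (\<lambda>x y. block_sum (half_block \<alpha>1 \<beta>1) (half_block \<alpha>2 \<beta>2) x y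
        + of_nat (class_dist (vert_class x) (vert_class y))))
    * ((\<alpha>1 * \<beta>1 - 2 * (\<alpha>1 + 2) * (of_nat r1 + of_nat r1)) * (\<alpha>2 * \<beta>2 - 2 * (\<alpha>2 + 2) * (of_nat r2 + of_nat r2)))
    = det (list_mat xs xs (half_block \<alpha>1 \<beta>1)) * det (list_mat ys ys (half_block \<alpha>2 \<beta>2))
    * det (list_mat class_list class_list
      (\<lambda>k l. block_sum (quotient_block \<alpha>1 \<beta>1 (of_nat r1)) (quotient_block \<alpha>2 \<beta>2 (of_nat r2)) k l
        + of_nat (class_dist k l) *
          of_nat (class_size (card (pverts G1)) (card (edge_set G1)) (card (pverts G2)) (card (edge_set G2)) l)))"
proof -
  interpret G1: regular_graph G1 r1 by fact
  interpret G2: regular_graph G2 r2 by fact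
  let ?W = "map Inl xs @ map Inr ys"
  let ?X = "block_sum (half_block \<alpha>1 \<beta>1) (half_block \<alpha>2 \<beta>2)"
  let ?Y = "block_sum (quotient_block \<alpha>1 \<beta>1 (of_nat r1)) (quotient_block \<alpha>2 \<beta>2 (of_nat r2))"
  let ?N = "class_size (card (pverts G1)) (card (edge_set G1)) (card (pverts G2)) (card (edge_set G2))"
  let ?U = "\<lambda>w k. of_bool (vert_class w = k) :: 'c"
  let ?V = "\<lambda>k w. of_nat (class_dist k (vert_class w)) :: 'c"
  note [simp del] = sum_of_bool_eq sum_mult_of_bool_eq sum_of_bool_mult_eq
  have fin: "finite (pverts G1 <+> edge_set G1)" "finite (pverts G2 <+> edge_set G2)"
    by (simp_all add: G1.pair_finite_verts G1.finite_edge_set G2.pair_finite_verts G2.finite_edge_set)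
  have W: "distinct ?W" "set ?W = (pverts G1 <+> edge_set G1) <+> (pverts G2 <+> edge_set G2)"
    using xs ys by (auto simp: distinct_map Plus_def)
  have cl: "distinct class_list" "set class_list = UNIV"
    by (auto simp: UNIV_bool_sum)
  have XU: "list_mat ?W ?W ?X * list_mat ?W class_list ?U = list_mat ?W class_list ?U * list_mat class_list class_list ?Y"
    unfolding list_mat_mult[OF W(1)] list_mat_mult[OF cl(1)] cl(2)
  proof (rule list_mat_cong)
    fix w k assume "w \<in> set ?W" "k \<in> set class_list"
    then have w: "w \<in> (pverts G1 <+> edge_set G1) <+> (pverts G2 <+> edge_set G2)"
      unfolding W(2) by simp
    have "(\<Sum>y\<in>set ?W. ?X w y * ?U y k) = ?Y (vert_class w) k"
    proof (cases w)
      case (Inl a)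
      then have "a \<in> pverts G1 <+> edge_set G1"
        using w by simp
      then show ?thesis
        unfolding W(2) sum.Plus[OF fin] Inl using G1.sum_half_block by (cases k) simp_all
    next
      case (Inr b)
      then have "b \<in> pverts G2 <+> edge_set G2"
        using w by simp
      then show ?thesis
        unfolding W(2) sum.Plus[OF fin] Inr using G2.sum_half_block by (cases k) simp_all
    qed
    also have "\<dots> = (\<Sum>l\<in>UNIV. ?U w l * ?Y l k)"
      by (simp add: if_distrib[of "\<lambda>x. x * _"] of_bool_def cong: if_cong)
    finally show "(\<Sum>y\<in>set ?W. ?X w y * ?U y k) = (\<Sum>l\<in>UNIV. ?U w l * ?Y l k)" .
  qed
  have UV: "list_mat ?W class_list ?U * list_mat class_list ?W ?V =
      list_mat ?W ?W (\<lambda>x y. of_nat (class_dist (vert_class x) (vert_class y)))"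
    unfolding list_mat_mult[OF cl(1)] cl(2)
    by (rule list_mat_cong) (simp add: if_distrib[of "\<lambda>x. x * _"] of_bool_def cong: if_cong)
  \<comment> \<open>Column \<open>l\<close> of \<open>U\<close> selects one class, on which the row
    of \<open>V\<close> is constant; the sum is that constant times the class size.\<close>
  have VU: "list_mat class_list ?W ?V * list_mat ?W class_list ?U =
      list_mat class_list class_list (\<lambda>k l. of_nat (class_dist k l) * of_nat (?N l))"
    unfolding list_mat_mult[OF W(1)]
  proof (rule list_mat_cong)
    fix k l
    have "(\<Sum>w\<in>set ?W. ?V k w * ?U w l) = (\<Sum>w\<in>set ?W. of_nat (class_dist k l) * ?U w l)"
      by (intro sum.cong) auto
    also have "\<dots> = of_nat (class_dist k l) * (\<Sum>w\<in>set ?W. ?U w l)"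
      by (simp add: sum_distrib_left)
    also have "(\<Sum>w\<in>set ?W. ?U w l) = of_nat (?N l)"
      unfolding W(2) 
      by (cases l) (simp_all add: sum.Plus G1.pair_finite_verts G1.finite_edge_set G2.pair_finite_verts
          G2.finite_edge_set)
    finally show "(\<Sum>w\<in>set ?W. ?V k w * ?U w l) = of_nat (class_dist k l) * of_nat (?N l)" .
  qed
  have "det (list_mat ?W ?W ?X + list_mat ?W class_list ?U * list_mat class_list ?W ?V) * det (list_mat class_list class_list ?Y)
      = det (list_mat ?W ?W ?X) * det (list_mat class_list class_list ?Y + list_mat class_list ?W ?V * list_mat ?W class_list ?U)"
    by (rule det_add_mult_intertwining[OF _ _ _ _ XU]) (rule list_mat_carrier)+
  then show ?thesis
    unfolding UV VU list_mat_add det_block_sum det_quotient_block .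
qed

section \<open>Transmissions of the vertices of the join\<close>

context regular_graph
begin

lemma sum_sub_dist_total:
  assumes "a \<in> V <+> E"
  shows "(\<Sum>b\<in>V <+> E. of_nat (sub_dist a b)) =
    (if edge_type a then 3 * of_nat (card V) - 4 + 4 * of_nat (card E) - 4 * of_nat r
      else 2 * of_nat (card V) - 2 + 3 * of_nat (card E) - 2 * of_nat r :: 'c :: comm_ring_1)"
  using assms pair_finite_verts finite_edge_set
  by (auto simp: sum.Plus sum_sub_dist simp del: sub_dist.simps)

lemma sum_edge_type: "(\<Sum>b\<in>V <+> E. c + of_bool (edge_type b)) = c * of_nat (card V) + (c + 1) * of_nat (card E)"
  for c :: "'c :: comm_ring_1"
  using pair_finite_verts finite_edge_set by (simp add: sum.Plus mult.commute)

lemma of_nat_card_edge_set: "of_nat (card E) = (of_nat (card V) * of_nat r / 2 :: 'c :: field_char_0)"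
proof -
  have "2 * of_nat (card E) = (of_nat (card V) * of_nat r :: 'c)"
    using arg_cong[OF double_card_edge_set, of "of_nat :: nat \<Rightarrow> 'c"] by (simp add: mult.commute)
  then show ?thesis
    by (simp add: field_simps)
qed

end

text \<open>Here \<open>p * r / 2\<close> and \<open>p' * r' / 2\<close> are the numbers of edges.\<close>

definition vert_transmission :: "'c :: field \<Rightarrow> 'c \<Rightarrow> 'c \<Rightarrow> 'c \<Rightarrow> 'c" where
  "vert_transmission p r p' r' = 2 * p - 2 + 3 * (p * r / 2) - 2 * r + p' + 2 * (p' * r' / 2)"

definition edge_transmission :: "'c :: field \<Rightarrow> 'c \<Rightarrow> 'c \<Rightarrow> 'c \<Rightarrow> 'c" where
  "edge_transmission p r p' r' = 3 * p - 4 + 4 * (p * r / 2) - 4 * r + 2 * p' + 3 * (p' * r' / 2)"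

lemma transmission_join:
  assumes G: "regular_graph G1 r1" "regular_graph G2 r2"
    and ne: "pverts G1 \<noteq> {}" "pverts G2 \<noteq> {}"
  defines "p1 \<equiv> real (card (pverts G1))" and "p2 \<equiv> real (card (pverts G2))"
  shows "a \<in> pverts G1 <+> edge_set G1 \<Longrightarrow> transmission (subdivision_vertex_join G1 G2) (Inl a) =
      (if edge_type a then edge_transmission p1 r1 p2 r2 else vert_transmission p1 r1 p2 r2)"
    and "b \<in> pverts G2 <+> edge_set G2 \<Longrightarrow> transmission (subdivision_vertex_join G1 G2) (Inr b) =
      (if edge_type b then edge_transmission p2 r2 p1 r1 else vert_transmission p2 r2 p1 r1)"
proof -
  interpret G1: regular_graph G1 r1 by fact
  interpret G2: regular_graph G2 r2 by fact
  let ?J = "subdivision_vertex_join G1 G2"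
  let ?S1 = "pverts G1 <+> edge_set G1" and ?S2 = "pverts G2 <+> edge_set G2"
  have fin: "finite ?S1" "finite ?S2"
    by (simp_all add: G1.pair_finite_verts G1.finite_edge_set G2.pair_finite_verts G2.finite_edge_set)
  have tr: "transmission ?J x = (\<Sum>y\<in>?S1. real (join_dist x (Inl y))) + (\<Sum>y\<in>?S2. real (join_dist x (Inr y)))"
    if "x \<in> pverts ?J" for x
  proof -
    have "transmission ?J x = (\<Sum>y\<in>pverts ?J. real (join_dist x y))"
      unfolding transmission_def
      using that ne by (intro sum.cong refl graph_dist_join) (auto intro: G1.pair_wf_digraph G2.pair_wf_digraph)
    then show ?thesis
      by (simp add: pverts_join sum.Plus[OF fin])
  qed
  note cards = G1.of_nat_card_edge_set[where 'c = real] G2.of_nat_card_edge_set[where 'c = real]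
  show "transmission ?J (Inl a) =
      (if edge_type a then edge_transmission p1 r1 p2 r2 else vert_transmission p1 r1 p2 r2)"
    if "a \<in> ?S1"
  proof -
    have "(\<Sum>y\<in>?S2. real (join_dist (Inl a) (Inr y))) =
        (\<Sum>y\<in>?S2. (1 + of_bool (edge_type a)) + of_bool (edge_type y))"
      by (intro sum.cong) auto
    then show ?thesis
      using that tr[of "Inl a"] unfolding G2.sum_edge_type
      by (cases "edge_type a") (simp_all add: pverts_join G1.sum_sub_dist_total[OF that] cards p1_def p2_def
          vert_transmission_def edge_transmission_def)
  qed
  show "transmission ?J (Inr b) =
      (if edge_type b then edge_transmission p2 r2 p1 r1 else vert_transmission p2 r2 p1 r1)"
    if "b \<in> ?S2"
  proof -
    have "(\<Sum>y\<in>?S1. real (join_dist (Inr b) (Inl y))) =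
        (\<Sum>y\<in>?S1. (1 + of_bool (edge_type b)) + of_bool (edge_type y))"
      by (intro sum.cong) auto
    then show ?thesis
      using that tr[of "Inr b"] unfolding G1.sum_edge_type
      by (cases "edge_type b") (simp_all add: pverts_join G2.sum_sub_dist_total[OF that] cards p1_def p2_def
          vert_transmission_def edge_transmission_def)
  qed
qed

text \<open>A row of \<open>half_block\<close> contains only the parameter of its own type, so a
  single diagonal value \<open>d\<close>, depending on the row, can fill both slots.\<close>

lemma half_block_type:
  assumes "d = (if edge_type a then \<beta> else \<alpha> + 2)"
  shows "half_block (d - 2) d a b = half_block \<alpha> \<beta> a b"
  using assms by (cases a; cases b) auto

section \<open>The quotient matrix and the quadratic factors\<close>

definition join_quotient_mat :: "real \<Rightarrow> real \<Rightarrow> real \<Rightarrow> real \<Rightarrow> real mat" where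
  "join_quotient_mat p1 r1 p2 r2 = mat_of_rows_list 4
    [[3/2 * p1 * r1 + p2 + p2 * r2 - 2 * r1, 2 * r1 - 3/2 * p1 * r1, - p2, - (p2 * r2)],
     [4 - 3 * p1, 3 * p1 + 2 * p2 + 3/2 * p2 * r2 - 4, - (2 * p2), - (3/2 * p2 * r2)],
     [- p1, - (p1 * r1), p1 + p1 * r1 + 3/2 * p2 * r2 - 2 * r2, 2 * r2 - 3/2 * p2 * r2],
     [- (2 * p1), - (3/2 * p1 * r1), 4 - 3 * p2, 2 * p1 + 3/2 * p1 * r1 + 3 * p2 - 4]]"

lemma join_quotient_mat_carrier: "join_quotient_mat p1 r1 p2 r2 \<in> carrier_mat 4 4"
  by (rule carrier_matI) (simp_all add: join_quotient_mat_def mat_of_rows_list_def)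

lemma poly_char_poly_join_quotient_mat:
  fixes p1 p2 q1 q2 r1 r2 :: nat and z :: complex
  assumes q: "2 * q1 = r1 * p1" "2 * q2 = r2 * p2"
  shows "poly (char_poly (map_mat complex_of_real (join_quotient_mat p1 r1 p2 r2))) z =
    det (list_mat class_list class_list
      (\<lambda>k l. block_sum (quotient_block (z - vert_transmission p1 r1 p2 r2 - 2) (z - edge_transmission p1 r1 p2 r2) r1)
          (quotient_block (z - vert_transmission p2 r2 p1 r1 - 2) (z - edge_transmission p2 r2 p1 r1) r2) k l
        + of_nat (class_dist k l) * of_nat (class_size p1 q1 p2 q2 l)))"
    (is "_ = det ?N")
proof -
  have q': "complex_of_nat q1 = of_nat p1 * of_nat r1 / 2" "complex_of_nat q2 = of_nat p2 * of_nat r2 / 2"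
    using q[THEN arg_cong, of complex_of_nat] by (simp_all add: field_simps)
  have M: "map_mat complex_of_real (join_quotient_mat p1 r1 p2 r2) \<in> carrier_mat 4 4"
    using join_quotient_mat_carrier by simp
  have i4: "i = 0 \<or> i = 1 \<or> i = 2 \<or> i = 3" if "i < 4" for i :: nat
    using that by auto
  show ?thesis
    unfolding poly_char_poly[OF M]
  proof (intro arg_cong[of _ _ det] eq_matI)
    fix i j assume "i < dim_row ?N" "j < dim_col ?N"
    then have ij: "i < 4" "j < 4"
      by simp_all
    show "(z \<cdot>\<^sub>m 1\<^sub>m 4 + (- 1) \<cdot>\<^sub>m map_mat complex_of_real (join_quotient_mat p1 r1 p2 r2)) $$ (i, j) =
        ?N $$ (i, j)"
      by (insert i4[OF ij(1)] i4[OF ij(2)], elim disjE) (simp_all add: join_quotient_mat_def mat_of_rows_list_def list_mat_def q'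
          vert_transmission_def edge_transmission_def numeral_2_eq_2 numeral_3_eq_3 field_simps)
  qed (use join_quotient_mat_carrier[of p1 r1 p2 r2] in auto)
qed

text \<open>An adjacency eigenvalue \<open>lam\<close> of a factor contributes the roots of
  \<open>\<alpha> \<beta> - 2 (\<alpha> + 2) (r + lam)\<close>; its discriminant is nonnegative since \<open>\<bar>lam\<bar> \<le> r\<close>.\<close>

definition pair_centre :: "real \<Rightarrow> real \<Rightarrow> real \<Rightarrow> real \<Rightarrow> real \<Rightarrow> real" where
  "pair_centre p r p' r' lam = lam + 5 * p / 2 + 3 * p' / 2 + 7 * p * r / 4 + 5 * p' * r' / 4 - 2 * r - 2"

text \<open>With \<open>s = r + lam\<close>, the quadratic equals
  \<open>(\<alpha>) * (\<beta> - 2 * s) - 4 * s\<close>. The square is that of the difference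
  between the zeros of the two linear factors, and \<open>16 * s\<close> is four times the remaining
  constant.\<close>

definition pair_disc :: "real \<Rightarrow> real \<Rightarrow> real \<Rightarrow> real \<Rightarrow> real \<Rightarrow> real" where
  "pair_disc p r p' r' lam = (2 * lam + p + p * r / 2 + p' + p' * r' / 2 - 4)\<^sup>2 + 16 * (lam + r)"

definition pair_poly :: "real \<Rightarrow> real \<Rightarrow> real \<Rightarrow> real \<Rightarrow> real \<Rightarrow> complex poly" where
  "pair_poly p r p' r' lam =
    [:- complex_of_real (pair_centre p r p' r' lam + 1/2 * sqrt (pair_disc p r p' r' lam)), 1:] *
    [:- complex_of_real (pair_centre p r p' r' lam - 1/2 * sqrt (pair_disc p r p' r' lam)), 1:]"

lemma pair_poly_nonzero: "pair_poly p r p' r' lam \<noteq> 0"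
  unfolding pair_poly_def by (simp del: mult_pCons_left mult_pCons_right)

lemma proots_pair_poly:
  "proots (pair_poly p r p' r' lam) = image_mset complex_of_real
    {# pair_centre p r p' r' lam + 1/2 * sqrt (pair_disc p r p' r' lam),
       pair_centre p r p' r' lam - 1/2 * sqrt (pair_disc p r p' r' lam) #}"
  unfolding pair_poly_def by (subst proots_mult) simp_all

lemma poly_pair_poly:
  assumes "lam + r \<ge> 0"
  shows "poly (pair_poly p r p' r' lam) z =
    (z - vert_transmission p r p' r' - 2) * (z - edge_transmission p r p' r')
    - 2 * (z - vert_transmission p r p' r' - 2 + 2) * (r + lam)"
proof -
  define c s where "c = pair_centre p r p' r' lam" and "s = sqrt (pair_disc p r p' r' lam)"
  define d where "d = 2 * lam + p + p * r / 2 + p' + p' * r' / 2 - 4"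
  \<comment> \<open>Nonnegativity makes the real \<open>sqrt\<close> square back to the
    discriminant; the identity then transfers to the complex numbers.\<close>
  have "pair_disc p r p' r' lam \<ge> 0"
    using assms by (simp add: pair_disc_def)
  then have "s\<^sup>2 = d\<^sup>2 + 16 * (lam + r)"
    by (simp add: s_def d_def pair_disc_def)
  then have s: "(complex_of_real s)\<^sup>2 = of_real d ^ 2 + 16 * (of_real lam + of_real r)"
    by (metis of_real_add of_real_mult of_real_numeral of_real_power)
  have "poly (pair_poly p r p' r' lam) z = (z - of_real c)\<^sup>2 - (of_real s)\<^sup>2 / 4"
    unfolding pair_poly_def c_def[symmetric] s_def[symmetric]
    by (simp add: field_simps power2_eq_square)
  also have "\<dots> = (z - of_real c)\<^sup>2 - (of_real d ^ 2 + 16 * (of_real lam + of_real r)) / 4"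
    unfolding s ..
  finally have eq: "poly (pair_poly p r p' r' lam) z =
    (z - of_real c)\<^sup>2 - (of_real d ^ 2 + 16 * (of_real lam + of_real r)) / 4" .
  show ?thesis
    unfolding eq c_def d_def pair_centre_def vert_transmission_def edge_transmission_def
    by (simp add: field_simps power2_eq_square)
qed

section \<open>One half of the join in terms of the adjacency spectrum\<close>

context regular_graph
begin

text \<open>The factor of the eigenvalue \<open>r\<close> is kept apart from the product over
  \<open>J\<close>, since it has to cancel against the quotient determinant of its half.\<close>

lemma det_half_block_spectrum:
  fixes p' r' :: real and lam :: "nat \<Rightarrow> real" and z :: complex
  assumes vs: "enumerates_verts vs G" and es: "distinct es" "set es = E"
    and spec: "eigenvalue_mset (adjacency_matrix vs G) =
      image_mset complex_of_real (add_mset (real r) (image_mset lam (mset_set J)))"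
    and J: "finite J"
  defines "p \<equiv> real (card V)"
  defines "\<alpha> \<equiv> z - vert_transmission p r p' r' - 2" and "\<beta> \<equiv> z - edge_transmission p r p' r'"
  shows "det (list_mat (map Inl vs @ map Inr es) (map Inl vs @ map Inr es) (half_block \<alpha> \<beta>)) * \<beta> ^ card V
    = \<beta> ^ card E * (poly (pair_poly p r p' r' r) z * (\<Prod>j\<in>J. poly (pair_poly p r p' r' (lam j)) z))"
proof -
  have nonneg: "lam j + real r \<ge> 0" if "j \<in> J" for j
  proof -
    have "complex_of_real (lam j) \<in># eigenvalue_mset (adjacency_matrix vs G)"
      using that J by (simp add: spec)
    then show ?thesis
      using norm_eigenvalue_adjacency_le[OF vs] by fastforce
  qed
  have "(\<Prod>a\<in>#eigenvalue_mset (adjacency_matrix vs G). \<alpha> * \<beta> - 2 * (\<alpha> + 2) * (of_nat r + a)) =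
      (\<alpha> * \<beta> - 2 * (\<alpha> + 2) * (of_nat r + of_real (real r))) *
      (\<Prod>j\<in>J. \<alpha> * \<beta> - 2 * (\<alpha> + 2) * (of_nat r + of_real (lam j)))"
    unfolding spec by (simp add: prod_unfold_prod_mset image_mset.compositionality o_def)
  also have "\<alpha> * \<beta> - 2 * (\<alpha> + 2) * (of_nat r + of_real (real r)) = poly (pair_poly p r p' r' r) z"
    by (subst poly_pair_poly) (simp_all add: \<alpha>_def \<beta>_def)
  also have "(\<Prod>j\<in>J. \<alpha> * \<beta> - 2 * (\<alpha> + 2) * (of_nat r + of_real (lam j))) =
      (\<Prod>j\<in>J. poly (pair_poly p r p' r' (lam j)) z)"
    using nonneg by (intro prod.cong refl, subst poly_pair_poly) (simp_all add: \<alpha>_def \<beta>_def)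
  finally show ?thesis
    using det_half_block[OF vs es, of \<alpha> \<beta>] by simp
qed

end

section \<open>Assembling the characteristic polynomial of the join\<close>

lemma distance_laplacian_list_mat:
  assumes vs: "enumerates_verts vs H"
  shows "map_mat complex_of_real (distance_laplacian_matrix vs H) = list_mat vs vs
    (\<lambda>x y. of_real ((if x = y then transmission H x else 0) - graph_dist H x y))"
  using vs by (intro eq_matI)
    (auto simp: distance_laplacian_matrix_def transmission_matrix_def distance_matrix_def list_mat_def
      mat_diag_def enumerates_verts_def nth_eq_iff_index_eq)

text \<open>The two \<open>pair_poly\<close> values on the left are the determinants of the quotient
  blocks. They may vanish at \<open>z\<close>, so they remain as factors here.\<close>

lemma poly_char_poly_join:
  fixes z :: complex
  assumes G: "regular_graph G1 r1" "regular_graph G2 r2"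
    and ne: "pverts G1 \<noteq> {}" "pverts G2 \<noteq> {}"
    and vs: "enumerates_verts vs (subdivision_vertex_join G1 G2)"
    and xs: "distinct xs" "set xs = pverts G1 <+> edge_set G1"
    and ys: "distinct ys" "set ys = pverts G2 <+> edge_set G2"
  defines "p1 \<equiv> real (card (pverts G1))" and "p2 \<equiv> real (card (pverts G2))"
  defines "\<alpha>1 \<equiv> z - vert_transmission p1 r1 p2 r2 - 2" and "\<beta>1 \<equiv> z - edge_transmission p1 r1 p2 r2"
    and "\<alpha>2 \<equiv> z - vert_transmission p2 r2 p1 r1 - 2" and "\<beta>2 \<equiv> z - edge_transmission p2 r2 p1 r1"
  shows "poly (char_poly (map_mat complex_of_real
      (distance_laplacian_matrix vs (subdivision_vertex_join G1 G2)))) z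
    * (poly (pair_poly p1 r1 p2 r2 r1) z * poly (pair_poly p2 r2 p1 r1 r2) z)
    = det (list_mat xs xs (half_block \<alpha>1 \<beta>1)) * det (list_mat ys ys (half_block \<alpha>2 \<beta>2))
    * poly (char_poly (map_mat complex_of_real (join_quotient_mat p1 r1 p2 r2))) z"
proof -
  interpret G1: regular_graph G1 r1 by fact
  interpret G2: regular_graph G2 r2 by fact
  let ?J = "subdivision_vertex_join G1 G2"
  let ?S1 = "pverts G1 <+> edge_set G1" and ?S2 = "pverts G2 <+> edge_set G2"
  let ?W = "map Inl xs @ map Inr ys"
  let ?F = "\<lambda>x y. (if x = y then z - of_real (transmission ?J x) else 0) + of_nat (join_dist x y)"
  let ?L = "map_mat complex_of_real (distance_laplacian_matrix vs ?J)"
  have wf: "pair_wf_digraph G1" "pair_wf_digraph G2"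
    by (auto intro: G1.pair_wf_digraph G2.pair_wf_digraph)
  have vs': "distinct vs" "set vs = ?S1 <+> ?S2"
    using vs by (auto simp: enumerates_verts_def pverts_join)
  have W: "distinct ?W" "set ?W = ?S1 <+> ?S2"
    using xs ys by (auto simp: distinct_map Plus_def)
  have L: "?L \<in> carrier_mat (length vs) (length vs)"
    by (simp add: distance_laplacian_list_mat[OF vs])
  have "z \<cdot>\<^sub>m 1\<^sub>m (length vs) + (- 1) \<cdot>\<^sub>m ?L = list_mat vs vs (\<lambda>x y.
      (if x = y then z else 0) - of_real ((if x = y then transmission ?J x else 0) - graph_dist ?J x y))"
    unfolding distance_laplacian_list_mat[OF vs] list_mat_one[OF vs'(1)]
    by (auto simp: list_mat_def)
  also have "\<dots> = list_mat vs vs ?F"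
    using vs' by (intro list_mat_cong) (simp add: graph_dist_join[OF wf ne] pverts_join)
  finally have "poly (char_poly ?L) z = det (list_mat vs vs ?F)"
    using poly_char_poly[OF L] by simp
  also have "\<dots> = det (list_mat ?W ?W ?F)"
    by (rule det_list_mat_cong_set) (use vs' W in simp_all)
  also have "list_mat ?W ?W ?F = list_mat ?W ?W
      (\<lambda>x y. block_sum (half_block \<alpha>1 \<beta>1) (half_block \<alpha>2 \<beta>2) x y + of_nat (class_dist (vert_class x) (vert_class y)))"
  proof (rule list_mat_cong)
    fix x y assume "x \<in> set ?W" "y \<in> set ?W"
    then have xy: "x \<in> ?S1 <+> ?S2" "y \<in> ?S1 <+> ?S2"
      unfolding W(2) .
    have F1: "?F (Inl a) (Inl b) = half_block \<alpha>1 \<beta>1 a b + (2 + of_bool (edge_type a) + of_bool (edge_type b))"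
      if "a \<in> ?S1" "b \<in> ?S1" for a b
    proof -
      define d where "d = z - of_real (transmission ?J (Inl a))"
      have "d = (if edge_type a then \<beta>1 else \<alpha>1 + 2)"
        unfolding d_def transmission_join(1)[OF G ne that(1)] by (simp add: \<alpha>1_def \<beta>1_def p1_def p2_def)
      then have "half_block (d - 2) d a b = half_block \<alpha>1 \<beta>1 a b"
        by (rule half_block_type)
      then show ?thesis
        using G1.sub_dist_half_block[OF that, of d] by (simp only: d_def join_dist.simps sum.inject)
    qed
    have F2: "?F (Inr a) (Inr b) = half_block \<alpha>2 \<beta>2 a b + (2 + of_bool (edge_type a) + of_bool (edge_type b))"
      if "a \<in> ?S2" "b \<in> ?S2" for a b
    proof -
      define d where "d = z - of_real (transmission ?J (Inr a))"
      have "d = (if edge_type a then \<beta>2 else \<alpha>2 + 2)"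
        unfolding d_def transmission_join(2)[OF G ne that(1)] by (simp add: \<alpha>2_def \<beta>2_def p1_def p2_def)
      then have "half_block (d - 2) d a b = half_block \<alpha>2 \<beta>2 a b"
        by (rule half_block_type)
      then show ?thesis
        using G2.sub_dist_half_block[OF that, of d] by (simp only: d_def join_dist.simps sum.inject)
    qed
    show "?F x y = block_sum (half_block \<alpha>1 \<beta>1) (half_block \<alpha>2 \<beta>2) x y + of_nat (class_dist (vert_class x) (vert_class y))"
    proof (cases x; cases y)
      fix a b assume [simp]: "x = Inl a" "y = Inl b"
      have ab: "a \<in> ?S1" "b \<in> ?S1"
        using xy by simp_all
      have "of_nat (class_dist (vert_class x) (vert_class y)) =
          (2 + of_bool (edge_type a) + of_bool (edge_type b) :: complex)"
        by simp
      then show ?thesis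
        using F1[OF ab] by (simp only: \<open>x = Inl a\<close> \<open>y = Inl b\<close> block_sum.simps)
    next
      fix a b assume [simp]: "x = Inr a" "y = Inr b"
      have ab: "a \<in> ?S2" "b \<in> ?S2"
        using xy by simp_all
      have "of_nat (class_dist (vert_class x) (vert_class y)) =
          (2 + of_bool (edge_type a) + of_bool (edge_type b) :: complex)"
        by simp
      then show ?thesis
        using F2[OF ab] by (simp only: \<open>x = Inr a\<close> \<open>y = Inr b\<close> block_sum.simps)
    qed simp_all
  qed
  finally have 1: "poly (char_poly ?L) z = det (list_mat ?W ?W (\<lambda>x y.
      block_sum (half_block \<alpha>1 \<beta>1) (half_block \<alpha>2 \<beta>2) x y + of_nat (class_dist (vert_class x) (vert_class y))))" .
  have 2: "poly (pair_poly p1 r1 p2 r2 r1) z = \<alpha>1 * \<beta>1 - 2 * (\<alpha>1 + 2) * (of_nat r1 + of_nat r1)"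
    "poly (pair_poly p2 r2 p1 r1 r2) z = \<alpha>2 * \<beta>2 - 2 * (\<alpha>2 + 2) * (of_nat r2 + of_nat r2)"
    by (simp_all add: poly_pair_poly \<alpha>1_def \<beta>1_def \<alpha>2_def \<beta>2_def)
  show ?thesis
    unfolding 1 2 det_join_block[OF G xs ys]
    unfolding p1_def p2_def \<alpha>1_def \<beta>1_def \<alpha>2_def \<beta>2_def
      poly_char_poly_join_quotient_mat[OF G1.double_card_edge_set G2.double_card_edge_set] ..
qed

lemma char_poly_join:
  fixes lam1 lam2 :: "nat \<Rightarrow> real"
  assumes G: "regular_graph G1 r1" "regular_graph G2 r2"
    and ne: "pverts G1 \<noteq> {}" "pverts G2 \<noteq> {}"
    and vs1: "enumerates_verts vs1 G1" and vs2: "enumerates_verts vs2 G2"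
    and vs: "enumerates_verts vs (subdivision_vertex_join G1 G2)"
    and J: "finite J1" "finite J2"
    and spec1: "eigenvalue_mset (adjacency_matrix vs1 G1) =
      image_mset complex_of_real (add_mset (real r1) (image_mset lam1 (mset_set J1)))"
    and spec2: "eigenvalue_mset (adjacency_matrix vs2 G2) =
      image_mset complex_of_real (add_mset (real r2) (image_mset lam2 (mset_set J2)))"
  defines "p1 \<equiv> real (card (pverts G1))" and "p2 \<equiv> real (card (pverts G2))"
  defines "b1 \<equiv> [:- complex_of_real (edge_transmission p1 r1 p2 r2), 1:]"
    and "b2 \<equiv> [:- complex_of_real (edge_transmission p2 r2 p1 r1), 1:]"
  shows "char_poly (map_mat complex_of_real (distance_laplacian_matrix vs (subdivision_vertex_join G1 G2)))
      * (b1 ^ card (pverts G1) * b2 ^ card (pverts G2))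
    = b1 ^ card (edge_set G1) * b2 ^ card (edge_set G2)
      * ((\<Prod>j\<in>J1. pair_poly p1 r1 p2 r2 (lam1 j)) * (\<Prod>j\<in>J2. pair_poly p2 r2 p1 r1 (lam2 j)))
      * char_poly (map_mat complex_of_real (join_quotient_mat p1 r1 p2 r2))"
    (is "?L * ?B = ?C * ?P * ?M")
proof -
  interpret G1: regular_graph G1 r1 by fact
  interpret G2: regular_graph G2 r2 by fact
  obtain es1 where es1: "distinct es1" "set es1 = edge_set G1"
    using finite_distinct_list[OF G1.finite_edge_set] by blast
  obtain es2 where es2: "distinct es2" "set es2 = edge_set G2"
    using finite_distinct_list[OF G2.finite_edge_set] by blast
  let ?D1 = "pair_poly p1 r1 p2 r2 r1" and ?D2 = "pair_poly p2 r2 p1 r1 r2"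
  let ?xs = "map Inl vs1 @ map Inr es1" and ?ys = "map Inl vs2 @ map Inr es2"
  have xs: "distinct ?xs" "set ?xs = pverts G1 <+> edge_set G1"
    using vs1 es1 by (auto simp: enumerates_verts_def distinct_map Plus_def)
  have ys: "distinct ?ys" "set ?ys = pverts G2 <+> edge_set G2"
    using vs2 es2 by (auto simp: enumerates_verts_def distinct_map Plus_def)
  have "poly ((?L * ?B) * (?D1 * ?D2)) z = poly ((?C * ?P * ?M) * (?D1 * ?D2)) z" for z
  proof -
    note main = poly_char_poly_join[OF G ne vs xs ys, of z, folded p1_def p2_def]
    note half1 = G1.det_half_block_spectrum[OF vs1 es1 spec1 J(1), of z p2 r2, folded p1_def]
    note half2 = G2.det_half_block_spectrum[OF vs2 es2 spec2 J(2), of z p1 r1, folded p2_def]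
    have b: "poly b1 z = z - edge_transmission p1 r1 p2 r2" "poly b2 z = z - edge_transmission p2 r2 p1 r1"
      by (simp_all add: b1_def b2_def)
    have comb: "(l * (B1 * B2)) * (d1 * d2) = (C1 * C2 * (P1 * P2) * m) * (d1 * d2)"
      if "l * (d1 * d2) = h1 * h2 * m" "h1 * B1 = C1 * (d1 * P1)" "h2 * B2 = C2 * (d2 * P2)"
      for l B1 B2 d1 d2 C1 C2 P1 P2 m h1 h2 :: complex
    proof -
      have "(l * (B1 * B2)) * (d1 * d2) = (h1 * B1) * (h2 * B2) * m"
        using that(1) by (simp add: algebra_simps)
      then show ?thesis
        unfolding that(2,3) by (simp add: algebra_simps)
    qed
    show ?thesis
      unfolding poly_mult poly_power poly_prod b
      by (rule comb[OF main half1 half2])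
  qed
  \<comment> \<open>Agreement at every complex number lifts the identity to polynomials, where
    \<open>?D1 * ?D2\<close> is nonzero and can be cancelled in spite of its roots.\<close>
  then have "(?L * ?B) * (?D1 * ?D2) = (?C * ?P * ?M) * (?D1 * ?D2)"
    by (intro poly_eq_poly_eq_iff[THEN iffD1] ext)
  then show ?thesis
    by (simp add: pair_poly_nonzero)
qed

section \<open>Reading off the eigenvalues with multiplicities\<close>

lemma regular_graphI_real:
  assumes H: "pair_graph H" "pverts H \<noteq> {}" "\<forall>v\<in>pverts H. real (out_degree (with_proj H) v) = r"
  shows "\<exists>k. regular_graph H k \<and> r = real k"
proof -
  obtain v where "v \<in> pverts H"
    using H(2) by blast
  then have r: "r = real (out_degree (with_proj H) v)"
    using H(3) by simp
  have "regular_graph H (out_degree (with_proj H) v)"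
    using H unfolding regular_graph_def regular_graph_axioms_def r by simp
  with r show ?thesis by blast
qed

lemma image_mset_sum: "image_mset f (\<Sum>j\<in>A. g j) = (\<Sum>j\<in>A. image_mset f (g j))"
  by (induction A rule: infinite_finite_induct) simp_all

lemma count_proots_linear_power:
  "count (proots ([:- a, 1:] ^ n)) z = (if z = a then n else 0)" for a z :: "'a :: idom"
  by (simp add: proots_power)

theorem theorem3p21:
  fixes G1 :: "'a pair_pre_digraph" and G2 :: "'b pair_pre_digraph"
    and p1 p2 r1 r2 :: real and lam1 lam2 :: "nat \<Rightarrow> real"
    and vs1 :: "'a list" and vs2 :: "'b list"
    and vs :: "(('a + 'a set) + ('b + 'b set)) list"
  assumes "pair_graph G1" and "pair_graph G2"
    and "pverts G1 \<noteq> {}" and "pverts G2 \<noteq> {}"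
    and "p1 = real (card (pverts G1))" and "p2 = real (card (pverts G2))"
    and "\<forall>v\<in>pverts G1. real (out_degree (with_proj G1) v) = r1"
    and "\<forall>v\<in>pverts G2. real (out_degree (with_proj G2) v) = r2"
    and "enumerates_verts vs1 G1" and "enumerates_verts vs2 G2"
    and "enumerates_verts vs (subdivision_vertex_join G1 G2)"
    and "eigenvalue_mset (adjacency_matrix vs1 G1) =
      image_mset complex_of_real
        (add_mset r1 (image_mset lam1 (mset_set {2..card (pverts G1)})))"
    and "eigenvalue_mset (adjacency_matrix vs2 G2) =
      image_mset complex_of_real
        (add_mset r2 (image_mset lam2 (mset_set {2..card (pverts G2)})))"
  shows
    "let
      \<Delta>1 = (\<lambda>j. 4 * (lam1 j)^2 + 2 * lam1 j * p1 * r1 + 4 * lam1 j * p1 + 2 * lam1 j * p2 * r2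
        + 4 * lam1 j * p2 + 1/4 * p1^2 * r1^2 + p1^2 * r1 + p1^2 + 1/2 * p1 * p2 * r1 * r2
        + p1 * p2 * r1 + p1 * p2 * r2 + 2 * p1 * p2 - 4 * p1 * r1 - 8 * p1
        + 1/4 * p2^2 * r2^2 + p2^2 * r2 + p2^2 - 4 * p2 * r2 - 8 * p2 + 16 * r1 + 16);
      \<Delta>2 = (\<lambda>j. 4 * (lam2 j)^2 + 2 * lam2 j * p1 * r1 + 4 * lam2 j * p1 + 2 * lam2 j * p2 * r2
        + 4 * lam2 j * p2 + 1/4 * p1^2 * r1^2 + p1^2 * r1 + p1^2 + 1/2 * p1 * p2 * r1 * r2
        + p1 * p2 * r1 + p1 * p2 * r2 + 2 * p1 * p2 - 4 * p1 * r1 - 8 * p1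
        + 1/4 * p2^2 * r2^2 + p2^2 * r2 + p2^2 - 4 * p2 * r2 - 8 * p2 + 16 * r2 + 16);
      c1 = (\<lambda>j. lam1 j + 5 * p1 / 2 + 3 * p2 / 2 + 7 * p1 * r1 / 4 + 5 * p2 * r2 / 4 - 2 * r1 - 2);
      c2 = (\<lambda>j. lam2 j + 3 * p1 / 2 + 5 * p2 / 2 + 5 * p1 * r1 / 4 + 7 * p2 * r2 / 4 - 2 * r2 - 2);
      E1 = (\<Sum>j\<in>{2..card (pverts G1)}.
        {# c1 j + 1/2 * sqrt (\<Delta>1 j), c1 j - 1/2 * sqrt (\<Delta>1 j) #});
      E2 = (\<Sum>j\<in>{2..card (pverts G2)}.
        {# c2 j + 1/2 * sqrt (\<Delta>2 j), c2 j - 1/2 * sqrt (\<Delta>2 j) #});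
      e3 = 3 * p1 + 2 * p1 * r1 + 2 * p2 + 3/2 * p2 * r2 - 4 * r1 - 4;
      e4 = 2 * p1 + 3/2 * p1 * r1 + 3 * p2 + 2 * p2 * r2 - 4 * r2 - 4;
      M = mat_of_rows_list 4
        [[3/2 * p1 * r1 + p2 + p2 * r2 - 2 * r1, 2 * r1 - 3/2 * p1 * r1, - p2, - (p2 * r2)],
         [4 - 3 * p1, 3 * p1 + 2 * p2 + 3/2 * p2 * r2 - 4, - (2 * p2), - (3/2 * p2 * r2)],
         [- p1, - (p1 * r1), p1 + p1 * r1 + 3/2 * p2 * r2 - 2 * r2, 2 * r2 - 3/2 * p2 * r2],
         [- (2 * p1), - (3/2 * p1 * r1), 4 - 3 * p2, 2 * p1 + 3/2 * p1 * r1 + 3 * p2 - 4]]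
    in \<forall>z.
      real (count (eigenvalue_mset
              (distance_laplacian_matrix vs (subdivision_vertex_join G1 G2))) z)
      = real (count (image_mset complex_of_real E1) z)
      + real (count (image_mset complex_of_real E2) z)
      + (if z = complex_of_real e3 then 1/2 * p1 * r1 - p1 else 0)
      + (if z = complex_of_real e4 then 1/2 * p2 * r2 - p2 else 0)
      + real (count (eigenvalue_mset M) z)"
proof -
  obtain k1 where G1: "regular_graph G1 k1" and r1: "r1 = real k1"
    using regular_graphI_real[OF assms(1,3,7)] by blast
  obtain k2 where G2: "regular_graph G2 k2" and r2: "r2 = real k2"
    using regular_graphI_real[OF assms(2,4,8)] by blast
  let ?L = "char_poly (map_mat complex_of_real (distance_laplacian_matrix vs (subdivision_vertex_join G1 G2)))"
  let ?M = "char_poly (map_mat complex_of_real (join_quotient_mat p1 r1 p2 r2))"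
  let ?b1 = "[:- complex_of_real (edge_transmission p1 r1 p2 r2), 1:]"
  let ?b2 = "[:- complex_of_real (edge_transmission p2 r2 p1 r1), 1:]"
  let ?P1 = "\<Prod>j\<in>{2..card (pverts G1)}. pair_poly p1 r1 p2 r2 (lam1 j)"
  let ?P2 = "\<Prod>j\<in>{2..card (pverts G2)}. pair_poly p2 r2 p1 r1 (lam2 j)"
  have eq: "?L * (?b1 ^ card (pverts G1) * ?b2 ^ card (pverts G2)) =
      ?b1 ^ card (edge_set G1) * ?b2 ^ card (edge_set G2) * (?P1 * ?P2) * ?M"
    using char_poly_join[OF G1 G2 assms(3,4,9-11) _ _ assms(12,13)[unfolded r1 r2]]
    by (simp add: assms(5,6) r1 r2)
  have carriers: "map_mat complex_of_real (distance_laplacian_matrix vs (subdivision_vertex_join G1 G2))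
        \<in> carrier_mat (length vs) (length vs)"
    "map_mat complex_of_real (join_quotient_mat p1 r1 p2 r2) \<in> carrier_mat 4 4"
    using join_quotient_mat_carrier by (simp_all add: distance_laplacian_list_mat[OF assms(11)])
  have nonzero: "?L \<noteq> 0" "?M \<noteq> 0" "?P1 \<noteq> 0" "?P2 \<noteq> 0" "?b1 ^ n \<noteq> 0" "?b2 ^ n \<noteq> 0" for n
    using carriers[THEN char_poly_nonzero] by (simp_all add: pair_poly_nonzero)
  have q1: "real (card (edge_set G1)) = 1/2 * p1 * r1"
    using regular_graph.of_nat_card_edge_set[OF G1, where 'c = real] by (simp add: assms(5) r1)
  have q2: "real (card (edge_set G2)) = 1/2 * p2 * r2"
    using regular_graph.of_nat_card_edge_set[OF G2, where 'c = real] by (simp add: assms(6) r2)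
  \<comment> \<open>Root counts are additive on both sides of \<open>eq\<close>; only after passing
    to the reals are the exponents subtracted, as there may be fewer edges than vertices.\<close>
  have cnt: "real (count (proots ?L) z) =
      real (count (proots ?P1) z) + real (count (proots ?P2) z)
      + (if z = complex_of_real (edge_transmission p1 r1 p2 r2) then 1/2 * p1 * r1 - p1 else 0)
      + (if z = complex_of_real (edge_transmission p2 r2 p1 r1) then 1/2 * p2 * r2 - p2 else 0)
      + real (count (proots ?M) z)" for z
  proof -
    have "proots (?L * (?b1 ^ card (pverts G1) * ?b2 ^ card (pverts G2))) =
        proots ?L + (proots (?b1 ^ card (pverts G1)) + proots (?b2 ^ card (pverts G2)))"
      using nonzero by (simp only: proots_mult no_zero_divisors simp_thms)
    moreover have "proots (?b1 ^ card (edge_set G1) * ?b2 ^ card (edge_set G2) * (?P1 * ?P2) * ?M) =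
        proots (?b1 ^ card (edge_set G1)) + proots (?b2 ^ card (edge_set G2)) + (proots ?P1 + proots ?P2) + proots ?M"
      using nonzero by (simp only: proots_mult no_zero_divisors simp_thms)
    ultimately have "count (proots ?L + (proots (?b1 ^ card (pverts G1)) + proots (?b2 ^ card (pverts G2)))) z =
        count (proots (?b1 ^ card (edge_set G1)) + proots (?b2 ^ card (edge_set G2)) + (proots ?P1 + proots ?P2)
          + proots ?M) z"
      using eq by metis
    then have "real (count (proots ?L) z)
        + ((if z = complex_of_real (edge_transmission p1 r1 p2 r2) then p1 else 0)
          + (if z = complex_of_real (edge_transmission p2 r2 p1 r1) then p2 else 0)) =
        (if z = complex_of_real (edge_transmission p1 r1 p2 r2) then real (card (edge_set G1)) else 0)
        + (if z = complex_of_real (edge_transmission p2 r2 p1 r1) then real (card (edge_set G2)) else 0)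
        + (real (count (proots ?P1) z) + real (count (proots ?P2) z)) + real (count (proots ?M) z)"
      unfolding count_union count_proots_linear_power assms(5,6)
      by (auto simp flip: of_nat_add simp del: of_nat_add)
    then show ?thesis
      unfolding q1 q2 by (simp split: if_splits)
  qed
  have roots1: "proots ?P1 = image_mset complex_of_real (\<Sum>j\<in>{2..card (pverts G1)}.
      {# pair_centre p1 r1 p2 r2 (lam1 j) + 1/2 * sqrt (pair_disc p1 r1 p2 r2 (lam1 j)),
         pair_centre p1 r1 p2 r2 (lam1 j) - 1/2 * sqrt (pair_disc p1 r1 p2 r2 (lam1 j)) #})"
    by (simp only: proots_prod pair_poly_nonzero proots_pair_poly image_mset_sum simp_thms ball_triv)
  \<comment> \<open>The second graph uses the same formulas with the two pairs of parameters
    exchanged.\<close>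
  have roots2: "proots ?P2 = image_mset complex_of_real (\<Sum>j\<in>{2..card (pverts G2)}.
      {# pair_centre p2 r2 p1 r1 (lam2 j) + 1/2 * sqrt (pair_disc p2 r2 p1 r1 (lam2 j)),
         pair_centre p2 r2 p1 r1 (lam2 j) - 1/2 * sqrt (pair_disc p2 r2 p1 r1 (lam2 j)) #})"
    by (simp only: proots_prod pair_poly_nonzero proots_pair_poly image_mset_sum simp_thms ball_triv)
  \<comment> \<open>The discriminant of the claim is the expansion of the square plus
    \<open>16 * (lam + r)\<close>; its \<open>- 16 * lam\<close> cancels the linear term of the
    latter, and \<open>16 * r1 + 16\<close> remains.\<close>
  have disc1: "pair_disc p1 r1 p2 r2 (lam1 j) = 4 * (lam1 j)^2 + 2 * lam1 j * p1 * r1 + 4 * lam1 j * p1 + 2 * lam1 j * p2 * r2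
        + 4 * lam1 j * p2 + 1/4 * p1^2 * r1^2 + p1^2 * r1 + p1^2 + 1/2 * p1 * p2 * r1 * r2
        + p1 * p2 * r1 + p1 * p2 * r2 + 2 * p1 * p2 - 4 * p1 * r1 - 8 * p1
        + 1/4 * p2^2 * r2^2 + p2^2 * r2 + p2^2 - 4 * p2 * r2 - 8 * p2 + 16 * r1 + 16" for j
    by (simp add: pair_disc_def power2_eq_square field_simps)
  have disc2: "pair_disc p2 r2 p1 r1 (lam2 j) = 4 * (lam2 j)^2 + 2 * lam2 j * p1 * r1 + 4 * lam2 j * p1 + 2 * lam2 j * p2 * r2
        + 4 * lam2 j * p2 + 1/4 * p1^2 * r1^2 + p1^2 * r1 + p1^2 + 1/2 * p1 * p2 * r1 * r2
        + p1 * p2 * r1 + p1 * p2 * r2 + 2 * p1 * p2 - 4 * p1 * r1 - 8 * p1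
        + 1/4 * p2^2 * r2^2 + p2^2 * r2 + p2^2 - 4 * p2 * r2 - 8 * p2 + 16 * r2 + 16" for j
    by (simp add: pair_disc_def power2_eq_square field_simps)
  have centre1: "pair_centre p1 r1 p2 r2 (lam1 j) =
      lam1 j + 5 * p1 / 2 + 3 * p2 / 2 + 7 * p1 * r1 / 4 + 5 * p2 * r2 / 4 - 2 * r1 - 2" for j
    by (simp add: pair_centre_def)
  have centre2: "pair_centre p2 r2 p1 r1 (lam2 j) =
      lam2 j + 3 * p1 / 2 + 5 * p2 / 2 + 5 * p1 * r1 / 4 + 7 * p2 * r2 / 4 - 2 * r2 - 2" for j
    by (simp add: pair_centre_def)
  have e3: "edge_transmission p1 r1 p2 r2 = 3 * p1 + 2 * p1 * r1 + 2 * p2 + 3/2 * p2 * r2 - 4 * r1 - 4"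
    by (simp add: edge_transmission_def)
  have e4: "edge_transmission p2 r2 p1 r1 = 2 * p1 + 3/2 * p1 * r1 + 3 * p2 + 2 * p2 * r2 - 4 * r2 - 4"
    by (simp add: edge_transmission_def)
  show ?thesis
    using cnt unfolding Let_def eigenvalue_mset_def roots1 roots2 disc1 disc2 centre1 centre2 e3 e4
      join_quotient_mat_def by blast
qed

end
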